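(* Let $P$ be the transition matrix of the random walk on a finite connected undirected (possibly weighted) graph $G$, let $s$ be its stationary distribution, and let $\alpha,\beta$ be the spectral quantities of $P$ defined in the context. Let $f$ be a real function on the vertices of $G$ with $\max_i|f(i)|=1$ and $\sum_i f(i)s(i)=0$, and let $V=\sum_i f(i)^2s(i)$. Let $q$ be any probability distribution on the vertices, let $(X_i)_{i\ge 0}$ be the walk with $X_0\sim q$, and let $S_n=\sum_{i=1}^n f(X_i)$. For $x,r\ge 0$ define $$\delta(x,r)=x\left(e^{2r}+V(e^r-1)^2\right),\qquad \Delta(x,r)=\frac{4xe^{2r}(e^r-1)^2}{1-\delta(x,r)}.$$ Then for every integer $n\ge 1$ and every real $\gamma$, $$\mathbb{P}_q\left(\frac1n S_n>\gamma\right)\le \min_{r\ge 0,\ \delta(\beta^2,r)\le 1}\ \left\|\frac{q}{\sqrt{s}}\right\|_2\exp\left(-\frac n2\left[2\gamma r-V\left(e^{2r}-1-2r+\Delta(\beta^2,r)\right)\right]\right)$$ and $$\mathbb{P}_q\left(\frac1n S_n>\gamma\right)\le \min_{r\ge 0,\ \delta(\alpha,r)\le 1}\ \left\|\frac{q}{\sqrt{s}}\right\|_2e^{2r}\exp\left(-n\left[2\gamma r-V\left(e^{2r}-1-2r+\Delta(\alpha,r)\right)\right]\right).$$ Here, for $r$ with $\delta(x,r)=1$, $\Delta(x,r)$ and the corresponding expression being minimised are understood as $+\infty$.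
   Context: $G$ is a finite undirected, possibly weighted (with positive edge weights), connected graph with $N$ vertices; random walks on such graphs represent exactly the finite irreducible reversible Markov chains. $P_{ij}$ is the probability of moving from vertex $j$ to vertex $i$ (so the columns of $P$ sum to $1$). $s$ is the unique stationary distribution, $Ps=s$, with $s(i)>0$ for all $i$; reversibility means $s(j)P_{ij}=s(i)P_{ji}$ for all $i,j$. The eigenvalues of $P$ are all real; the top eigenvalue is $1$, it is simple, and all other eigenvalues have absolute value at most $1$. $\alpha<1$ is the maximum of $0$ and the second largest eigenvalue of $P$. $\beta\le 1$ is the second largest absolute value of an eigenvalue of $P$, i.e. the largest absolute value among the eigenvalues other than the simple eigenvalue $1$. $X_0,X_1,\ldots$ is the trajectory of the walk (Markov chain with transition matrix $P$) with starting distribution $q$, and $\mathbb{P}_q$ is the corresponding probability. Expressions in vectors are coordinatewise, so $\left\|\frac{q}{\sqrt s}\right\|_2=\left(\sum_i q(i)^2/s(i)\right)^{1/2}$. *)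

theory Defs
  imports "HOL-Probability.Probability"
begin

text \<open>
  The vertex set is a finite type. A graph is given by its symmetric non-negative weight function,
  with an edge (possibly a loop) between two vertices iff the weight is positive. An unweighted
  graph has weights in \<open>{0, 1}\<close>.
\<close>

definition connected_weighted_graph :: "('v::finite \<Rightarrow> 'v \<Rightarrow> real) \<Rightarrow> bool" where
  "connected_weighted_graph w \<longleftrightarrow>
     (\<forall>i j. w i j \<ge> 0) \<and>
     (\<forall>i j. w i j = w j i) \<and>
     (\<forall>i j. (i, j) \<in> {(u, v). w u v > 0}\<^sup>*)"

text \<open>
  Entry \<open>(i, j)\<close> is the probability of moving from \<open>j\<close> to \<open>i\<close>, so it is the columns that sum
  to \<open>1\<close> and distributions are column vectors.
\<close>

definition transition_matrix :: "('v::finite \<Rightarrow> 'v \<Rightarrow> real) \<Rightarrow> real ^ 'v ^ 'v" where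
  "transition_matrix w = (\<chi> i j. w j i / (\<Sum>k\<in>UNIV. w j k))"

definition prob_vector :: "real ^ 'v::finite \<Rightarrow> bool" where
  "prob_vector q \<longleftrightarrow> (\<forall>i. q $ i \<ge> 0) \<and> (\<Sum>i\<in>UNIV. q $ i) = 1"

definition stationary_distribution :: "real ^ 'v ^ 'v \<Rightarrow> real ^ 'v::finite \<Rightarrow> bool" where
  "stationary_distribution P s \<longleftrightarrow> prob_vector s \<and> P *v s = s"

text \<open>
  Only real eigenvalues are collected: a reversible transition matrix has no others.
\<close>

definition eigenvalues :: "real ^ 'v ^ 'v::finite \<Rightarrow> real set" where
  "eigenvalues P = {l. \<exists>v. v \<noteq> 0 \<and> P *v v = l *\<^sub>R v}"

text \<open>
  For a connected graph the eigenvalue \<open>1\<close> is simple and is the largest one, so the remaining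
  spectrum is obtained by deleting \<open>1\<close> from the set of eigenvalues. That set difference is
  empty only on a one-vertex graph, where there is no second eigenvalue and \<open>Max\<close> has no
  meaningful value.
\<close>

definition second_eigenvalue :: "real ^ 'v ^ 'v::finite \<Rightarrow> real" where
  "second_eigenvalue P = Max (eigenvalues P - {1})"

definition spec_alpha :: "real ^ 'v ^ 'v::finite \<Rightarrow> real" where
  "spec_alpha P = max 0 (second_eigenvalue P)"

definition spec_beta :: "real ^ 'v ^ 'v::finite \<Rightarrow> real" where
  "spec_beta P = Max (abs ` (eigenvalues P - {1}))"

definition random_walk ::
  "'a measure \<Rightarrow> real ^ 'v ^ 'v \<Rightarrow> real ^ 'v::finite \<Rightarrow> (nat \<Rightarrow> 'a \<Rightarrow> 'v) \<Rightarrow> bool" where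
  "random_walk M P q X \<longleftrightarrow>
     prob_space M \<and>
     (\<forall>n. X n \<in> measurable M (count_space UNIV)) \<and>
     (\<forall>i. \<P>(\<omega> in M. X 0 \<omega> = i) = q $ i) \<and>
     (\<forall>n x. \<P>(\<omega> in M. \<forall>k\<le>n. X k \<omega> = x k) > 0 \<longrightarrow>
        \<P>(\<omega> in M. X (Suc n) \<omega> = x (Suc n) \<bar> \<forall>k\<le>n. X k \<omega> = x k) = P $ x (Suc n) $ x n)"

definition delta :: "real \<Rightarrow> real \<Rightarrow> real \<Rightarrow> real" where
  "delta V x r = x * (exp (2 * r) + V * (exp r - 1)\<^sup>2)"

definition Delta :: "real \<Rightarrow> real \<Rightarrow> real \<Rightarrow> real" where
  "Delta V x r = 4 * x * exp (2 * r) * (exp r - 1)\<^sup>2 / (1 - delta V x r)"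

definition weighted_norm :: "real ^ 'v \<Rightarrow> real ^ 'v::finite \<Rightarrow> real" where
  "weighted_norm q s = norm (\<chi> i. q $ i / sqrt (s $ i))"

text \<open>
  The expressions to be minimised over \<open>r\<close>, with \<open>c\<close> the norm of \<open>q / sqrt s\<close>. They are
  extended reals because they are \<open>\<infinity>\<close> where the denominator of \<^const>\<open>Delta\<close> vanishes.
\<close>

definition beta_bound :: "real \<Rightarrow> real \<Rightarrow> real \<Rightarrow> nat \<Rightarrow> real \<Rightarrow> real \<Rightarrow> ereal" where
  "beta_bound c V b n \<gamma> r =
     (if delta V (b\<^sup>2) r = 1 then \<infinity>
      else ereal (c * exp (- (real n / 2) *
             (2 * \<gamma> * r - V * (exp (2 * r) - 1 - 2 * r + Delta V (b\<^sup>2) r)))))"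

definition alpha_bound :: "real \<Rightarrow> real \<Rightarrow> real \<Rightarrow> nat \<Rightarrow> real \<Rightarrow> real \<Rightarrow> ereal" where
  "alpha_bound c V a n \<gamma> r =
     (if delta V a r = 1 then \<infinity>
      else ereal (c * exp (2 * r) * exp (- real n *
             (2 * \<gamma> * r - V * (exp (2 * r) - 1 - 2 * r + Delta V a r)))))"

end

theory Submission
  imports Defs
begin

text \<open>
  With \<open>D = diag s\<close>, reversibility makes \<open>S = D^(-1/2) P D^(1/2)\<close> symmetric with unit eigenvector \<open>u = \<surd>s\<close>
  for the eigenvalue \<open>1\<close>. Let \<open>E\<close> be multiplication by \<open>exp (r f)\<close>. Integrating out the
  positions one at a time rewrites the exponential moment of \<open>f(X\<^sub>1) + \<dots> + f(X\<^sub>n)\<close> as an inner product,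
  \<open>\<langle>q/\<surd>s, (S E)\<^sup>n u\<rangle>\<close> for the parameter \<open>r\<close> and \<open>\<langle>q/\<surd>s, (S E\<^sup>2)\<^sup>n u\<rangle>\<close> for the parameter \<open>2r\<close>, so by
  Cauchy-Schwarz and Markov's inequality only operator norms remain to be estimated
  (\<open>expectation_exp_sum\<close>, \<open>chernoff_bound\<close>, \<open>transfer_le_norm_twisted\<close>).

  The first bound uses the norm of \<open>S E\<close>, whose square is the maximum of \<open>\<parallel>S E v\<parallel>\<^sup>2\<close> over unit
  vectors \<open>v\<close>. The second one conjugates \<open>S E\<^sup>2\<close> to the symmetric matrix \<open>E S E\<close>, at the cost of
  the factor \<open>exp (2 r)\<close>; its entries are non-negative, so its norm is the maximum of its quadratic form
  \<open>\<langle>E v, S E v\<rangle>\<close>, whatever the negative eigenvalues of \<open>S\<close>. In both cases the spectral theorem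
  bounds the quantity by \<open>\<langle>E v, A E v\<rangle>\<close>, where \<open>A\<close> has the eigenvalue \<open>1\<close> on \<open>u\<close> and \<open>x\<close> on the
  orthogonal complement of \<open>u\<close>; here \<open>x = \<beta>\<^sup>2\<close> for \<open>S\<^sup>2\<close> and \<open>x = \<alpha>\<close> for \<open>S\<close>
  (\<open>norm_symm_sq_le\<close>, \<open>quadratic_form_symm_le\<close>).

  Now \<open>E A E\<close> and \<open>A^(1/2) E\<^sup>2 A^(1/2)\<close> have the same top eigenvalue, and in the second form the
  perturbation is easy to control. Splitting a vector along \<open>u\<close> and its complement gives a
  two-by-two form with diagonal entries at most \<open>1 + V (exp (2 r) - 1 - 2 r)\<close> and \<open>x exp (2 r)\<close>, because \<open>f\<close>
  has mean zero and variance \<open>V\<close>, and with off-diagonal entry at most \<open>sqrt (x V) (exp (2 r) - 1)\<close>.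
  Completing the square bounds its top eigenvalue by
  \<open>1 + V (exp (2 r) - 1 - 2 r) + x V (exp (2 r) - 1)\<^sup>2 / (1 - x exp (2 r))\<close> (\<open>gap_form_tilt_le\<close>), and the
  exponential with \<open>\<Delta>(x, r)\<close> dominates this number (\<open>tilt_growth_le_exp\<close>).

  That the minima over \<open>r\<close> exist is a compactness argument (\<open>ex_arg_min_exp_bound\<close>): for
  \<open>0 < x < 1\<close> the exponent tends to infinity as \<open>\<delta>(x, r)\<close> tends to \<open>1\<close>, for \<open>x = 0\<close> it does so as \<open>r\<close>
  grows over the now unbounded range, and for \<open>x = 1\<close> the only admissible \<open>r\<close> is \<open>0\<close>, with an
  infinite bound.
\<close>

section \<open>Self-adjoint operators with a known top eigenvector\<close>

text \<open>
  A maximiser of the quadratic form on the unit sphere of the invariant subspace is an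
  eigenvector. This part of the spectral theorem turns bounds on the
  eigenvalues in a subspace into bounds on the quadratic form there.
\<close>

lemma self_adjoint_max_eigenvector:
  fixes T :: "'a::euclidean_space \<Rightarrow> 'a"
  assumes lin: "linear T" and sa: "\<And>v w. T v \<bullet> w = v \<bullet> T w"
    and W: "subspace W" "W \<noteq> {0}" and inv: "\<And>w. w \<in> W \<Longrightarrow> T w \<in> W"
  obtains \<mu> v where "v \<in> W" "norm v = 1" "T v = \<mu> *\<^sub>R v"
    "\<And>w. w \<in> W \<Longrightarrow> w \<bullet> T w \<le> \<mu> * (norm w)\<^sup>2"
proof -
  define K where "K = W \<inter> sphere 0 1"
  have "compact K"
    unfolding K_def using closed_subspace[OF W(1)] by (simp add: closed_Int_compact)
  have norm1: "(1 / norm w) *\<^sub>R w \<in> K" if "w \<in> W" "w \<noteq> 0" for w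
    using that W(1) by (simp add: K_def subspace_scale)
  have "0 \<in> W" using W(1) by (rule subspace_0)
  with W(2) have "K \<noteq> {}" using norm1 by fastforce
  have "continuous_on K (\<lambda>w. w \<bullet> T w)"
    by (intro continuous_intros linear_continuous_on linear_conv_bounded_linear[THEN iffD1] lin)
  with \<open>compact K\<close> \<open>K \<noteq> {}\<close> obtain v where v: "v \<in> K" "\<And>w. w \<in> K \<Longrightarrow> w \<bullet> T w \<le> v \<bullet> T v"
    using continuous_attains_sup by metis
  define \<mu> where "\<mu> = v \<bullet> T v"
  have vW: "v \<in> W" "norm v = 1" using v(1) by (auto simp: K_def)
  have vv: "v \<bullet> v = 1" using vW(2) by (simp add: dot_square_norm)
  have bound: "w \<bullet> T w \<le> \<mu> * (norm w)\<^sup>2" if "w \<in> W" for w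
  proof (cases "w = 0")
    case False
    have "((1 / norm w) *\<^sub>R w) \<bullet> T ((1 / norm w) *\<^sub>R w) \<le> \<mu>"
      using v(2)[OF norm1[OF that False]] by (simp add: \<mu>_def)
    then show ?thesis
      using False by (simp add: linear_scale[OF lin] field_simps power2_eq_square)
  qed (simp add: linear_0[OF lin])
  define d where "d = \<mu> *\<^sub>R v - T v"
  have dW: "d \<in> W"
    unfolding d_def using W(1) vW inv by (simp add: subspace_diff subspace_scale)
  have dv: "d \<bullet> v = 0"
    unfolding d_def \<mu>_def by (simp add: inner_diff_left vv inner_commute[of "T v" v])
  \<comment> \<open>Moving from the maximiser \<open>v\<close> in the direction of the residual \<open>d\<close> would change the
    quadratic form at first order unless \<open>d = 0\<close>.\<close>
  define C where "C = \<mu> * (d \<bullet> d) - d \<bullet> T d"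
  have quad: "0 \<le> 2 * e * (d \<bullet> d) + e\<^sup>2 * C" for e :: real
  proof -
    have "v + e *\<^sub>R d \<in> W"
      using W(1) vW dW by (simp add: subspace_add subspace_scale)
    from bound[OF this] have "(v + e *\<^sub>R d) \<bullet> T (v + e *\<^sub>R d) \<le> \<mu> * ((v + e *\<^sub>R d) \<bullet> (v + e *\<^sub>R d))"
      by (simp add: dot_square_norm)
    moreover have "v \<bullet> T d = d \<bullet> T v" using sa[of v d] by (simp add: inner_commute)
    moreover have "d \<bullet> T v = - (d \<bullet> d)"
    proof -
      have "T v = \<mu> *\<^sub>R v - d" by (simp add: d_def)
      then have "d \<bullet> T v = \<mu> * (d \<bullet> v) - d \<bullet> d" by (simp add: inner_diff_right)
      then show ?thesis using dv by simp
    qed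
    moreover have "v \<bullet> d = 0" using dv by (simp add: inner_commute)
    ultimately show ?thesis
      by (simp add: linear_add[OF lin] linear_scale[OF lin] inner_add_left inner_add_right
          vv dv C_def algebra_simps power2_eq_square flip: \<mu>_def)
  qed
  have "d = 0"
  proof (rule ccontr)
    assume "d \<noteq> 0"
    then have D: "d \<bullet> d > 0" by simp
    define e where "e = - (d \<bullet> d) / (\<bar>C\<bar> + 1)"
    have e0: "e < 0" using D by (simp add: e_def divide_neg_pos)
    have "(- e) * C \<le> (- e) * \<bar>C\<bar>"
      using e0 by (intro mult_left_mono) auto
    also have "\<dots> \<le> d \<bullet> d"
      using D by (simp add: e_def divide_simps mult_left_mono)
    finally have "0 < 2 * (d \<bullet> d) + e * C" using D by linarith
    then have "e * (2 * (d \<bullet> d) + e * C) < 0" using e0 by (simp add: mult_neg_pos)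
    with quad[of e] show False by (simp add: algebra_simps power2_eq_square)
  qed
  then have "T v = \<mu> *\<^sub>R v" by (simp add: d_def)
  with that vW bound show thesis by blast
qed

text \<open>
  The quadratic form of the operator that is the identity on the line of the unit vector \<open>u\<close>
  and multiplication by \<open>x\<close> on its orthogonal complement.
\<close>

definition gap_form :: "'a::real_inner \<Rightarrow> real \<Rightarrow> 'a \<Rightarrow> real" where
  "gap_form u x v = (u \<bullet> v)\<^sup>2 + x * ((norm v)\<^sup>2 - (u \<bullet> v)\<^sup>2)"

text \<open>
  The complement of \<open>u\<close> is invariant, and on it the largest value of the form on unit vectors
  is an eigenvalue.
\<close>

lemma quadratic_form_le_gap_form:
  fixes T :: "'a::euclidean_space \<Rightarrow> 'a"
  assumes lin: "linear T" and sa: "\<And>v w. T v \<bullet> w = v \<bullet> T w"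
    and u: "norm u = 1" "T u = u"
    and eig: "\<And>\<mu> v. v \<noteq> 0 \<Longrightarrow> u \<bullet> v = 0 \<Longrightarrow> T v = \<mu> *\<^sub>R v \<Longrightarrow> \<mu> \<le> x"
  shows "v \<bullet> T v \<le> gap_form u x v"
proof -
  define W where "W = {w. u \<bullet> w = 0}"
  have W: "subspace W" unfolding W_def by (rule subspace_hyperplane)
  have inv: "T w \<in> W" if "w \<in> W" for w
    using that sa[of u w] u by (simp add: W_def)
  have perp: "z \<bullet> T z \<le> x * (norm z)\<^sup>2" if "z \<in> W" for z
  proof (cases "W = {0}")
    case True
    then show ?thesis using that by (simp add: linear_0[OF lin])
  next
    case False
    obtain \<mu> y where y: "y \<in> W" "norm y = 1" "T y = \<mu> *\<^sub>R y"
        and b: "\<And>w. w \<in> W \<Longrightarrow> w \<bullet> T w \<le> \<mu> * (norm w)\<^sup>2"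
      by (rule self_adjoint_max_eigenvector[OF lin sa W False inv]) fast+
    have "y \<noteq> 0" using y(2) by auto
    then have "\<mu> \<le> x" using eig y(1,3) unfolding W_def mem_Collect_eq by blast
    then have "\<mu> * (norm z)\<^sup>2 \<le> x * (norm z)\<^sup>2" by (simp add: mult_right_mono)
    with b[OF that] show ?thesis by linarith
  qed
  have uu: "u \<bullet> u = 1" using u(1) by (simp add: dot_square_norm)
  define a where "a = u \<bullet> v"
  define z where "z = v - a *\<^sub>R u"
  have zW: "z \<in> W" by (simp add: W_def z_def a_def inner_diff_right uu)
  have v: "v = a *\<^sub>R u + z" by (simp add: z_def)
  have uz: "u \<bullet> z = 0" "z \<bullet> u = 0" "u \<bullet> T z = 0"
    using zW inv[OF zW] unfolding W_def mem_Collect_eq inner_commute[of z u] by simp_all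
  have "v \<bullet> T v = a\<^sup>2 + z \<bullet> T z"
    unfolding v by (simp add: linear_add[OF lin] linear_scale[OF lin] u inner_add_left
        inner_add_right uz uu power2_eq_square)
  moreover have "(norm v)\<^sup>2 = a\<^sup>2 + (norm z)\<^sup>2"
    unfolding v power2_norm_eq_inner by (simp add: inner_add_left inner_add_right uz uu power2_eq_square)
  ultimately show ?thesis
    using perp[OF zW] unfolding gap_form_def a_def[symmetric] by simp
qed

text \<open>
  \<open>(norm (T v))\<^sup>2\<close> is the quadratic form of the square of \<open>T\<close>, whose eigenvalues are squares
  of those of \<open>T\<close>; this is where negative eigenvalues of \<open>T\<close> enter.
\<close>

lemma norm_sq_le_gap_form:
  fixes T :: "'a::euclidean_space \<Rightarrow> 'a"
  assumes lin: "linear T" and sa: "\<And>v w. T v \<bullet> w = v \<bullet> T w"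
    and u: "norm u = 1" "T u = u"
    and eig: "\<And>\<mu> v. v \<noteq> 0 \<Longrightarrow> u \<bullet> v = 0 \<Longrightarrow> T v = \<mu> *\<^sub>R v \<Longrightarrow> \<bar>\<mu>\<bar> \<le> b"
  shows "(norm (T v))\<^sup>2 \<le> gap_form u (b\<^sup>2) v"
proof -
  have "v \<bullet> (T \<circ> T) v \<le> gap_form u (b\<^sup>2) v"
  proof (rule quadratic_form_le_gap_form)
    show "linear (T \<circ> T)" using lin by (simp add: linear_compose)
    show "(T \<circ> T) v \<bullet> w = v \<bullet> (T \<circ> T) w" for v w by (simp add: sa)
    show "norm u = 1" "(T \<circ> T) u = u" using u by auto
  next
    fix \<mu> v assume v: "v \<noteq> 0" "u \<bullet> v = 0" "(T \<circ> T) v = \<mu> *\<^sub>R v"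
    have "\<mu> * (norm v)\<^sup>2 = (norm (T v))\<^sup>2"
      using v(3) sa[of v "T v"] by (simp add: power2_norm_eq_inner)
    then have "\<mu> \<ge> 0"
      using v(1) by (metis zero_le_mult_iff zero_le_power2 zero_less_norm_iff zero_less_power not_le)
    define m where "m = sqrt \<mu>"
    have m: "m\<^sup>2 = \<mu>" using \<open>\<mu> \<ge> 0\<close> by (simp add: m_def)
    \<comment> \<open>\<open>(T - m) (T + m) v = 0\<close>, so one of \<open>m\<close> and \<open>-m\<close> is an eigenvalue of \<open>T\<close>.\<close>
    define y where "y = T v + m *\<^sub>R v"
    have "\<bar>m\<bar> \<le> b"
    proof (cases "y = 0")
      case True
      then have "T v = (- m) *\<^sub>R v" by (simp add: y_def eq_neg_iff_add_eq_0)
      from eig[OF v(1,2) this] show ?thesis by simp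
    next
      case False
      have "u \<bullet> T v = 0" using sa[of u v] u v(2) by simp
      then have "u \<bullet> y = 0" by (simp add: y_def inner_add_right v(2))
      moreover have "T y = m *\<^sub>R y"
        using v(3) by (simp add: y_def linear_add[OF lin] linear_scale[OF lin] scaleR_add_right
            flip: m power2_eq_square)
      ultimately show ?thesis using eig[OF False] by blast
    qed
    then show "\<mu> \<le> b\<^sup>2" using abs_le_square_iff[of m b] m by simp
  qed
  then show ?thesis by (simp add: power2_norm_eq_inner flip: sa)
qed

text \<open>
  \<open>B A\<close> is the adjoint of \<open>A B\<close>, and adjoint operators have the same norm.
\<close>

lemma norm_self_adjoint_comp_le:
  fixes A B :: "'a::real_inner \<Rightarrow> 'a"
  assumes A: "\<And>v w. A v \<bullet> w = v \<bullet> A w" and B: "\<And>v w. B v \<bullet> w = v \<bullet> B w"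
    and bound: "\<And>y. (norm (A (B y)))\<^sup>2 \<le> L * (norm y)\<^sup>2"
  shows "(norm (B (A v)))\<^sup>2 \<le> L * (norm v)\<^sup>2"
proof (cases "B (A v) = 0")
  case True
  have "0 \<le> (norm (A (B v)))\<^sup>2" by simp
  also have "\<dots> \<le> L * (norm v)\<^sup>2" by (rule bound)
  finally show ?thesis using True by simp
next
  case False
  define y where "y = B (A v)"
  have "(norm y)\<^sup>2 = A (B y) \<bullet> v"
    by (simp add: power2_norm_eq_inner y_def A B)
  also have "\<dots> \<le> norm (A (B y)) * norm v" by (rule norm_cauchy_schwarz)
  finally have "((norm y)\<^sup>2)\<^sup>2 \<le> (norm (A (B y)) * norm v)\<^sup>2" by (rule power_mono) simp
  also have "\<dots> \<le> (L * (norm y)\<^sup>2) * (norm v)\<^sup>2"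
    unfolding power_mult_distrib by (intro mult_right_mono bound) simp
  finally have "(norm y)\<^sup>2 * (norm y)\<^sup>2 \<le> (norm y)\<^sup>2 * (L * (norm v)\<^sup>2)"
    by (simp add: power2_eq_square mult_ac)
  moreover have "(norm y)\<^sup>2 > 0" using False by (simp add: y_def)
  ultimately have "(norm y)\<^sup>2 \<le> L * (norm v)\<^sup>2" by (rule mult_left_le_imp_le)
  then show ?thesis by (simp add: y_def)
qed

text \<open>
  The positivity hypothesis says that the matrix of \<open>T\<close> has non-negative entries. Replacing a
  vector by its vector of absolute values then shows that \<open>L\<close> also bounds the form from below, in
  the elementary part of the Perron-Frobenius theorem; by polarisation a self-adjoint operator
  with \<open>\<bar>v \<bullet> T v\<bar> \<le> L * (norm v)\<^sup>2\<close> has norm at most \<open>L\<close>.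
\<close>

lemma norm_le_of_nonneg_self_adjoint:
  fixes T :: "real ^ 'v \<Rightarrow> real ^ 'v::finite"
  assumes lin: "linear T" and sa: "\<And>v w. T v \<bullet> w = v \<bullet> T w"
    and pos: "\<And>v i. \<bar>T v $ i\<bar> \<le> T (\<chi> j. \<bar>v $ j\<bar>) $ i"
    and form: "\<And>v. v \<bullet> T v \<le> L * (norm v)\<^sup>2"
  shows "norm (T v) \<le> L * norm v"
proof -
  have L: "\<bar>y \<bullet> T y\<bar> \<le> L * (norm y)\<^sup>2" for y
  proof -
    let ?y = "\<chi> j. \<bar>y $ j\<bar>"
    have "\<bar>y \<bullet> T y\<bar> \<le> (\<Sum>i\<in>UNIV. \<bar>y $ i * T y $ i\<bar>)"
      unfolding inner_vec_def by (simp add: sum_abs)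
    also have "\<dots> \<le> (\<Sum>i\<in>UNIV. \<bar>y $ i\<bar> * T ?y $ i)"
      unfolding abs_mult by (intro sum_mono mult_left_mono pos) simp
    also have "\<dots> = ?y \<bullet> T ?y" by (simp add: inner_vec_def)
    also have "\<dots> \<le> L * (norm ?y)\<^sup>2" by (rule form)
    also have "norm ?y = norm y" by (simp add: norm_vec_def L2_set_def)
    finally show ?thesis .
  qed
  have polar: "y \<bullet> T w \<le> L / 2 * ((norm y)\<^sup>2 + (norm w)\<^sup>2)" for y w
  proof -
    have "y \<bullet> T w = ((y + w) \<bullet> T (y + w) - (y - w) \<bullet> T (y - w)) / 4"
      using sa[of y w] by (simp add: linear_add[OF lin] linear_diff[OF lin] inner_add_left
        inner_add_right inner_diff_left inner_diff_right inner_commute)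
    also have "\<dots> \<le> (L * (norm (y + w))\<^sup>2 + L * (norm (y - w))\<^sup>2) / 4"
      using abs_le_D1[OF L[of "y + w"]] abs_le_D2[OF L[of "y - w"]] by (intro divide_right_mono) auto
    also have "\<dots> = L / 2 * ((norm y)\<^sup>2 + (norm w)\<^sup>2)"
      by (simp add: power2_norm_eq_inner inner_add_left
        inner_add_right inner_diff_left inner_diff_right algebra_simps)
    finally show ?thesis .
  qed
  show ?thesis
  proof (cases "T v = 0 \<or> v = 0")
    case True
    then have "T v = 0" using linear_0[OF lin] by auto
    have "0 \<le> L * norm v * norm v" using L[of v] by (simp add: power2_eq_square mult.assoc)
    then have "0 \<le> L * norm v"
      by (metis linorder_not_less mult_neg_pos mult_zero_right norm_eq_zero zero_less_norm_iff less_irrefl)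
    with \<open>T v = 0\<close> show ?thesis by simp
  next
    case False
    \<comment> \<open>The scaling that makes both arguments of \<open>polar\<close> equally long.\<close>
    define c where "c = norm v / norm (T v)"
    have "c * (norm (T v))\<^sup>2 = (c *\<^sub>R T v) \<bullet> T v" by (simp add: power2_norm_eq_inner)
    also have "\<dots> \<le> L / 2 * ((norm (c *\<^sub>R T v))\<^sup>2 + (norm v)\<^sup>2)" by (rule polar)
    also have "norm (c *\<^sub>R T v) = norm v" using False by (simp add: c_def)
    finally have "norm v * norm (T v) \<le> norm v * (L * norm v)"
      using False by (simp add: c_def power2_eq_square field_simps)
    then show ?thesis using False by simp
  qed
qed

section \<open>Perturbation of the quadratic form by an exponential weight\<close>

text \<open>
  Term by term in the power series: for \<open>n \<ge> 2\<close> the power \<open>y ^ n\<close> is at most \<open>y\<^sup>2\<close>. Averaged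
  over a centred \<open>y\<close> the linear term vanishes and the variance comes out as a factor.
\<close>

lemma exp_centred_le:
  fixes t y :: real
  assumes "0 \<le> t" "\<bar>y\<bar> \<le> 1"
  shows "exp (t * y) \<le> 1 + t * y + y\<^sup>2 * (exp t - 1 - t)"
proof -
  let ?f = "\<lambda>x n. inverse (fact (n + 2)) *\<^sub>R (x::real) ^ (n + 2)"
  have sm: "summable (?f x)" for x :: real
    using summable_exp_generic[of x] by (subst summable_iff_shift)
  have "(\<Sum>n. ?f (t * y) n) \<le> (\<Sum>n. y\<^sup>2 * ?f t n)"
  proof (intro suminf_le sm summable_mult)
    fix n
    have "y ^ n \<le> \<bar>y\<bar> ^ n" by (metis abs_ge_self power_abs)
    also have "\<dots> \<le> 1" using assms by (simp add: power_le_one)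
    finally have "(t ^ (n + 2) * y\<^sup>2) * y ^ n \<le> (t ^ (n + 2) * y\<^sup>2) * 1"
      using assms by (intro mult_left_mono) auto
    then show "?f (t * y) n \<le> y\<^sup>2 * ?f t n"
      by (simp add: power_mult_distrib power_add power2_eq_square mult_ac divide_right_mono del: fact_Suc
          flip: divide_inverse)
  qed
  also have "\<dots> = y\<^sup>2 * (\<Sum>n. ?f t n)" using sm by (rule suminf_mult)
  finally show ?thesis
    unfolding exp_first_two_terms[of "t * y"] exp_first_two_terms[of t] by (simp add: algebra_simps)
qed

lemma abs_exp_minus_one_le:
  fixes t y :: real
  assumes "0 \<le> t" "\<bar>y\<bar> \<le> 1"
  shows "\<bar>exp (t * y) - 1\<bar> \<le> \<bar>y\<bar> * (exp t - 1)"
proof -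
  let ?f = "\<lambda>x n. inverse (fact (Suc n)) *\<^sub>R (x::real) ^ Suc n"
  have sm: "summable (?f x)" for x :: real
    using summable_exp_generic[of x] by (subst summable_Suc_iff)
  have le: "norm (?f (t * y) n) \<le> \<bar>y\<bar> * ?f t n" for n
  proof -
    have "\<bar>y\<bar> ^ n \<le> 1" using assms by (simp add: power_le_one)
    then have "(t ^ Suc n * \<bar>y\<bar>) * \<bar>y\<bar> ^ n \<le> (t ^ Suc n * \<bar>y\<bar>) * 1"
      using assms by (intro mult_left_mono) auto
    then have "t ^ Suc n * \<bar>y\<bar> ^ Suc n \<le> t ^ Suc n * \<bar>y\<bar>" by (simp add: mult_ac)
    then show ?thesis using assms(1)
      by (simp add: abs_mult power_abs power_mult_distrib divide_right_mono field_simps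
          del: fact_Suc power_Suc)
  qed
  have "\<bar>\<Sum>n. ?f (t * y) n\<bar> \<le> (\<Sum>n. \<bar>y\<bar> * ?f t n)"
    using norm_suminf_le[of "?f (t * y)" "\<lambda>n. \<bar>y\<bar> * ?f t n"] le summable_mult[OF sm] by simp
  also have "\<dots> = \<bar>y\<bar> * (\<Sum>n. ?f t n)" using sm by (rule suminf_mult)
  finally show ?thesis
    unfolding exp_first_term[of "t * y"] exp_first_term[of t] by simp
qed

definition tilt :: "real \<Rightarrow> ('v \<Rightarrow> real) \<Rightarrow> real ^ 'v \<Rightarrow> real ^ 'v::finite" where
  "tilt t f v = (\<chi> i. exp (t * f i) * v $ i)"

lemma linear_tilt: "linear (tilt t f)"
  by (rule linearI) (auto simp: tilt_def vec_eq_iff algebra_simps)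

lemma tilt_self_adjoint: "tilt t f v \<bullet> w = v \<bullet> tilt t f w"
  by (simp add: tilt_def inner_vec_def mult_ac)

lemma norm_sq_vec: "(norm v)\<^sup>2 = (\<Sum>i\<in>UNIV. (v $ i)\<^sup>2)" for v :: "real ^ 'v::finite"
  unfolding power2_norm_eq_inner by (simp add: inner_vec_def power2_eq_square)

lemma norm_tilt_le:
  assumes "0 \<le> t" "\<And>i. \<bar>f i\<bar> \<le> 1"
  shows "norm (tilt t f v) \<le> exp t * norm v"
proof (rule power2_le_imp_le)
  have "exp (t * f i) \<le> exp t" for i
    using assms(1) mult_left_mono[of "f i" 1 t] assms(2)[of i] by simp
  then have "(exp (t * f i) * v $ i)\<^sup>2 \<le> (exp t)\<^sup>2 * (v $ i)\<^sup>2" for i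
    unfolding power_mult_distrib by (intro mult_right_mono power_mono) auto
  then show "(norm (tilt t f v))\<^sup>2 \<le> (exp t * norm v)\<^sup>2"
    unfolding power_mult_distrib norm_sq_vec tilt_def vec_lambda_beta sum_distrib_left
    by (intro sum_mono)
qed simp

text \<open>
  The bound for the top eigenvalue that results from completing the square in the
  two-by-two form.
\<close>

definition tilt_growth :: "real \<Rightarrow> real \<Rightarrow> real \<Rightarrow> real" where
  "tilt_growth V x r =
     1 + V * (exp (2 * r) - 1 - 2 * r) + x * V * (exp (2 * r) - 1)\<^sup>2 / (1 - x * exp (2 * r))"

lemma two_mult_le_add:
  fixes c p q :: real
  assumes "0 \<le> p" "0 \<le> q" "c\<^sup>2 \<le> p * q"
  shows "2 * c \<le> p + q"
proof (rule power2_le_imp_le)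
  have "0 \<le> (p - q)\<^sup>2" by simp
  then show "(2 * c)\<^sup>2 \<le> (p + q)\<^sup>2"
    using assms(3) by (simp add: power2_eq_square algebra_simps)
qed (use assms in simp)

text \<open>
  The form on the left is \<open>(norm (B (tilt r f v)))\<^sup>2\<close>, where \<open>B\<close> is the square root of the operator of
  \<open>gap_form\<close>. It is enough to estimate the two operators composed in the other order: there the
  small factor \<open>sqrt x\<close> acts before the weight and multiplies the off-diagonal term.
\<close>

lemma gap_form_tilt_le:
  fixes u v :: "real ^ 'v::finite"
  assumes u: "norm u = 1" and f: "\<And>i. \<bar>f i\<bar> \<le> 1" and mean: "(\<Sum>i\<in>UNIV. f i * (u $ i)\<^sup>2) = 0"
    and V: "V = (\<Sum>i\<in>UNIV. (f i)\<^sup>2 * (u $ i)\<^sup>2)"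
    and x: "0 \<le> x" "x * exp (2 * r) < 1" and r: "0 \<le> r"
  shows "gap_form u x (tilt r f v) \<le> tilt_growth V x r * (norm v)\<^sup>2"
proof -
  have uu: "u \<bullet> u = 1" using u by (simp add: dot_square_norm)
  define B where "B = (\<lambda>y. (u \<bullet> y) *\<^sub>R u + sqrt x *\<^sub>R (y - (u \<bullet> y) *\<^sub>R u))"
  have B_sa: "B y \<bullet> w = y \<bullet> B w" for y w
    by (simp add: B_def inner_add_left inner_add_right inner_diff_left inner_diff_right
        inner_commute[of y u] algebra_simps)
  have B_norm: "(norm (B y))\<^sup>2 = gap_form u x y" for y
  proof -
    define z where "z = y - (u \<bullet> y) *\<^sub>R u"
    have z: "u \<bullet> z = 0" "z \<bullet> u = 0"
      by (simp_all add: z_def inner_diff_right inner_diff_left uu inner_commute[of y u])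
    have "y = (u \<bullet> y) *\<^sub>R u + z" by (simp add: z_def)
    then have "y \<bullet> y = ((u \<bullet> y) *\<^sub>R u + z) \<bullet> ((u \<bullet> y) *\<^sub>R u + z)" by simp
    then have "y \<bullet> y = (u \<bullet> y)\<^sup>2 + z \<bullet> z"
      by (simp add: inner_add_left inner_add_right z uu power2_eq_square)
    moreover have "B y \<bullet> B y = (u \<bullet> y)\<^sup>2 + x * (z \<bullet> z)"
      using x(1) by (simp add: B_def inner_add_left inner_add_right z uu power2_eq_square mult.assoc[symmetric]
          flip: z_def)
    ultimately show ?thesis by (simp add: gap_form_def power2_norm_eq_inner)
  qed
  define g where "g = (\<lambda>i. exp (2 * r * f i))"
  define k where "k = exp (2 * r) - 1"
  define D where "D = 1 - x * exp (2 * r)"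
  define L where "L = tilt_growth V x r"
  have V0: "V \<ge> 0" unfolding V by (intro sum_nonneg) auto
  have D: "D > 0" using x(2) by (simp add: D_def)
  have p1: "exp (2 * r) - 1 - 2 * r \<ge> 0" using exp_ge_add_one_self[of "2 * r"] by linarith
  have L_eq: "L = 1 + V * (exp (2 * r) - 1 - 2 * r) + x * V * k\<^sup>2 / D"
    by (simp add: L_def tilt_growth_def k_def D_def)
  have "x * V * k\<^sup>2 / D \<ge> 0" using V0 x(1) D by simp
  then have L1: "L \<ge> 1" using V0 p1 by (simp add: L_eq)
  have usum: "(\<Sum>i\<in>UNIV. (u $ i)\<^sup>2) = 1" using u norm_sq_vec[of u] by simp
  have "(norm (tilt r f (B y)))\<^sup>2 \<le> L * (norm y)\<^sup>2" for y
  proof -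
    define a where "a = u \<bullet> y"
    define z where "z = y - a *\<^sub>R u"
    define Z where "Z = (norm z)\<^sup>2"
    have uz: "u \<bullet> z = 0" by (simp add: z_def inner_diff_right uu a_def)
    have y: "y = a *\<^sub>R u + z" by (simp add: z_def)
    have ny: "(norm y)\<^sup>2 = a\<^sup>2 + Z"
      unfolding y Z_def power2_norm_eq_inner
      using uz by (simp add: inner_add_left inner_add_right uu inner_commute[of z u] power2_eq_square)
    define S1 where "S1 = (\<Sum>i\<in>UNIV. g i * (u $ i)\<^sup>2)"
    define S2 where "S2 = (\<Sum>i\<in>UNIV. (g i - 1) * u $ i * z $ i)"
    define S3 where "S3 = (\<Sum>i\<in>UNIV. g i * (z $ i)\<^sup>2)"
    have S1: "S1 \<le> 1 + V * (exp (2 * r) - 1 - 2 * r)"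
    proof -
      have "S1 \<le> (\<Sum>i\<in>UNIV. (1 + 2 * r * f i + (f i)\<^sup>2 * (exp (2 * r) - 1 - 2 * r)) * (u $ i)\<^sup>2)"
        unfolding S1_def g_def using r f by (intro sum_mono mult_right_mono exp_centred_le) auto
      also have "\<dots> = (\<Sum>i\<in>UNIV. (u $ i)\<^sup>2) + 2 * r * (\<Sum>i\<in>UNIV. f i * (u $ i)\<^sup>2)
          + V * (exp (2 * r) - 1 - 2 * r)"
        unfolding V sum_distrib_left sum_distrib_right sum.distrib[symmetric]
        by (intro sum.cong refl) (simp add: algebra_simps)
      finally show ?thesis using mean usum by simp
    qed
    \<comment> \<open>Orthogonality of \<open>u\<close> and \<open>z\<close> has replaced \<open>g\<close> by \<open>g - 1\<close>, which is small and carries the factor \<open>f\<close>.\<close>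
    have S2: "S2\<^sup>2 \<le> V * k\<^sup>2 * Z"
    proof -
      define y2 where "y2 = (\<chi> i. (g i - 1) * u $ i)"
      have "(norm y2)\<^sup>2 = (\<Sum>i\<in>UNIV. \<bar>g i - 1\<bar>\<^sup>2 * (u $ i)\<^sup>2)"
        unfolding norm_sq_vec by (simp add: y2_def power_mult_distrib)
      also have "\<dots> \<le> (\<Sum>i\<in>UNIV. (\<bar>f i\<bar> * k)\<^sup>2 * (u $ i)\<^sup>2)"
        unfolding g_def k_def using r f
        by (intro sum_mono mult_right_mono power_mono abs_exp_minus_one_le) auto
      also have "\<dots> = V * k\<^sup>2"
        unfolding V sum_distrib_right by (intro sum.cong refl) (simp add: power_mult_distrib)
      finally have "(norm y2)\<^sup>2 \<le> V * k\<^sup>2" .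
      moreover have "S2 = y2 \<bullet> z" by (simp add: S2_def y2_def inner_vec_def)
      then have "S2\<^sup>2 \<le> (norm y2)\<^sup>2 * Z"
        unfolding Z_def power2_norm_eq_inner using Cauchy_Schwarz_ineq[of y2 z] by simp
      ultimately show ?thesis
        by (smt (verit, best) Z_def mult_right_mono zero_le_power2)
    qed
    have S3: "S3 \<le> exp (2 * r) * Z"
    proof -
      have "g i \<le> exp (2 * r)" for i
        unfolding g_def using r mult_left_mono[of "f i" 1 "2 * r"] f[of i] by simp
      then show ?thesis
        unfolding S3_def Z_def norm_sq_vec sum_distrib_left by (intro sum_mono mult_right_mono) auto
    qed
    have "B y = a *\<^sub>R u + sqrt x *\<^sub>R z" by (simp add: B_def a_def z_def)
    then have "(norm (tilt r f (B y)))\<^sup>2 = (\<Sum>i\<in>UNIV. g i * (a * u $ i + sqrt x * z $ i)\<^sup>2)"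
      unfolding norm_sq_vec by (simp add: tilt_def g_def power_mult_distrib mult.assoc flip: exp_double)
    also have "\<dots> = (\<Sum>i\<in>UNIV. a\<^sup>2 * (g i * (u $ i)\<^sup>2) + 2 * (a * sqrt x) * ((g i - 1) * u $ i * z $ i)
        + x * (g i * (z $ i)\<^sup>2) + 2 * (a * sqrt x) * (u $ i * z $ i))"
    proof (rule sum.cong[OF refl])
      fix i
      have "x = sqrt x * sqrt x" using x(1) by simp
      then show "g i * (a * u $ i + sqrt x * z $ i)\<^sup>2 = a\<^sup>2 * (g i * (u $ i)\<^sup>2)
        + 2 * (a * sqrt x) * ((g i - 1) * u $ i * z $ i)
        + x * (g i * (z $ i)\<^sup>2) + 2 * (a * sqrt x) * (u $ i * z $ i)"
        by algebra
    qed
    also have "\<dots> = a\<^sup>2 * S1 + 2 * (a * sqrt x) * S2 + x * S3 + 2 * (a * sqrt x) * (u \<bullet> z)"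
      by (simp add: S1_def S2_def S3_def inner_vec_def sum.distrib sum_distrib_left)
    also have "\<dots> = a\<^sup>2 * S1 + 2 * (a * sqrt x * S2) + x * S3" by (simp add: uz)
    \<comment> \<open>The weights are chosen so that \<open>D * Z\<close> fills the diagonal entry \<open>x * exp (2 * r)\<close> up to \<open>1\<close>.\<close>
    also have "2 * (a * sqrt x * S2) \<le> a\<^sup>2 * (x * V * k\<^sup>2 / D) + D * Z"
    proof (rule two_mult_le_add)
      show "0 \<le> a\<^sup>2 * (x * V * k\<^sup>2 / D)" "0 \<le> D * Z" using x(1) V0 D by (simp_all add: Z_def)
      have "(a * sqrt x * S2)\<^sup>2 = a\<^sup>2 * x * S2\<^sup>2" using x(1) by (simp add: power_mult_distrib)
      also have "\<dots> \<le> a\<^sup>2 * x * (V * k\<^sup>2 * Z)" using x(1) by (intro mult_left_mono S2) auto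
      also have "\<dots> = a\<^sup>2 * (x * V * k\<^sup>2 / D) * (D * Z)" using D by simp
      finally show "(a * sqrt x * S2)\<^sup>2 \<le> a\<^sup>2 * (x * V * k\<^sup>2 / D) * (D * Z)" .
    qed
    also have "a\<^sup>2 * S1 \<le> a\<^sup>2 * (1 + V * (exp (2 * r) - 1 - 2 * r))" using S1 by (intro mult_left_mono) auto
    also have "x * S3 \<le> x * (exp (2 * r) * Z)" using S3 x(1) by (intro mult_left_mono) auto
    also have "a\<^sup>2 * (1 + V * (exp (2 * r) - 1 - 2 * r)) + (a\<^sup>2 * (x * V * k\<^sup>2 / D) + D * Z)
        + x * (exp (2 * r) * Z) = L * a\<^sup>2 + Z"
      by (simp add: L_eq D_def algebra_simps)
    also have "\<dots> \<le> L * a\<^sup>2 + L * Z"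
    proof -
      have "0 \<le> Z" by (simp add: Z_def)
      from mult_right_mono[OF L1 this] show ?thesis by simp
    qed
    also have "\<dots> = L * (norm y)\<^sup>2" by (simp add: ny algebra_simps)
    finally show ?thesis by simp
  qed
  then have "(norm (B (tilt r f v)))\<^sup>2 \<le> L * (norm v)\<^sup>2"
    by (rule norm_self_adjoint_comp_le[OF tilt_self_adjoint B_sa])
  then show ?thesis by (simp add: B_norm L_def)
qed

text \<open>
  \<open>exp (2 r) - 1 = (exp r + 1) (exp r - 1)\<close> with \<open>exp r + 1 \<le> 2 exp r\<close>, and \<open>delta\<close> is at least
  \<open>x exp (2 r)\<close>, so that \<open>V * Delta\<close> has the larger numerator and the smaller denominator. The rest is
  \<open>1 + y \<le> exp y\<close>.
\<close>

lemma tilt_growth_le_exp: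
  assumes "0 \<le> V" "0 \<le> x" "0 \<le> r" "delta V x r < 1"
  shows "tilt_growth V x r \<le> exp (V * (exp (2 * r) - 1 - 2 * r + Delta V x r))"
proof -
  have e: "exp r \<ge> 1" using assms(3) by simp
  have E: "exp (2 * r) = (exp r)\<^sup>2" by (simp add: exp_double)
  have "(exp (2 * r) - 1)\<^sup>2 = (exp r + 1)\<^sup>2 * (exp r - 1)\<^sup>2"
    unfolding E by algebra
  also have "\<dots> \<le> (2 * exp r)\<^sup>2 * (exp r - 1)\<^sup>2"
    using e by (intro mult_right_mono power_mono) auto
  finally have num: "(exp (2 * r) - 1)\<^sup>2 \<le> 4 * exp (2 * r) * (exp r - 1)\<^sup>2"
    by (simp add: E power_mult_distrib)
  have "x * (V * (exp r - 1)\<^sup>2) \<ge> 0" using assms by simp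
  then have den: "1 - delta V x r \<le> 1 - x * exp (2 * r)" by (simp add: delta_def algebra_simps)
  have "x * V * (exp (2 * r) - 1)\<^sup>2 / (1 - x * exp (2 * r))
     \<le> x * V * (4 * exp (2 * r) * (exp r - 1)\<^sup>2) / (1 - delta V x r)"
    using assms num den by (intro frac_le mult_left_mono) auto
  then have "tilt_growth V x r \<le> 1 + V * (exp (2 * r) - 1 - 2 * r + Delta V x r)"
    by (simp add: tilt_growth_def Delta_def algebra_simps)
  also have "\<dots> \<le> exp (V * (exp (2 * r) - 1 - 2 * r + Delta V x r))" by simp
  finally show ?thesis .
qed

section \<open>Attainment of the minimum over the parameter\<close>

text \<open>
  A common shape for the exponents of \<^const>\<open>beta_bound\<close> (\<open>m = n / 2\<close>, \<open>b = 0\<close>) and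
  \<^const>\<open>alpha_bound\<close> (\<open>m = n\<close>, \<open>b = 2\<close>).
\<close>

definition exponent :: "real \<Rightarrow> real \<Rightarrow> real \<Rightarrow> real \<Rightarrow> real \<Rightarrow> real \<Rightarrow> real" where
  "exponent V x m b \<gamma> r = b * r - m * (2 * \<gamma> * r - V * (exp (2 * r) - 1 - 2 * r + Delta V x r))"

text \<open>
  At \<open>r = 0\<close> the exponent is \<open>0\<close>, so the infimum can be sought on the set \<open>K\<close> where it is
  non-positive. Clearing the denominator of \<^const>\<open>Delta\<close> describes \<open>K\<close> by weak inequalities between
  continuous functions, so \<open>K\<close> is closed although \<open>delta V x r < 1\<close> is an open condition. It is bounded
  since \<open>exp (2 r) - 1 - 2 r\<close> is at least \<open>2 r\<^sup>2\<close>, which beats the linear terms because \<open>V > 0\<close>.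
\<close>

lemma exponent_attains_min:
  assumes V: "0 < V" and x: "0 \<le> x" "x < 1" and m: "0 < m"
  obtains r0 where "0 \<le> r0" "delta V x r0 < 1"
    "\<And>r. 0 \<le> r \<Longrightarrow> delta V x r < 1 \<Longrightarrow> exponent V x m b \<gamma> r0 \<le> exponent V x m b \<gamma> r"
proof -
  define N where "N = (\<lambda>r. m * V * (4 * x * exp (2 * r) * (exp r - 1)\<^sup>2))"
  define H where "H = (\<lambda>r. (2 * m * \<gamma> - b) * r - m * V * (exp (2 * r) - 1 - 2 * r))"
  define K where "K = {r. 0 \<le> r \<and> delta V x r < 1 \<and> exponent V x m b \<gamma> r \<le> 0}"
  have K_iff: "r \<in> K \<longleftrightarrow> 0 \<le> r \<and> delta V x r \<le> 1 \<and> N r \<le> (1 - delta V x r) * H r" for r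
  proof (cases "delta V x r = 1 \<or> r < 0")
    case True
    \<comment> \<open>On the boundary the inequality of the claim reads \<open>N r \<le> 0\<close> and so excludes it.\<close>
    have "N r > 0" if "delta V x r = 1" "0 \<le> r"
    proof -
      have "x \<noteq> 0" "r \<noteq> 0" using that x by (auto simp: delta_def)
      then show ?thesis using V x m by (simp add: N_def)
    qed
    with True show ?thesis by (auto simp: K_def)
  next
    case False
    then have ne: "1 - delta V x r \<noteq> 0" by simp
    have "exponent V x m b \<gamma> r = N r / (1 - delta V x r) - H r"
      by (simp add: exponent_def N_def H_def Delta_def algebra_simps)
    then have mult: "(1 - delta V x r) * exponent V x m b \<gamma> r = N r - (1 - delta V x r) * H r"
      using ne by (simp only: right_diff_distrib) simp
    show ?thesis
    proof (cases "delta V x r < 1")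
      case True
      then have "exponent V x m b \<gamma> r \<le> 0 \<longleftrightarrow> (1 - delta V x r) * exponent V x m b \<gamma> r \<le> 0"
        by (simp add: mult_le_0_iff)
      also have "\<dots> \<longleftrightarrow> N r \<le> (1 - delta V x r) * H r" unfolding mult by linarith
      finally show ?thesis using True False unfolding K_def mem_Collect_eq by simp
    qed (use False in \<open>simp add: K_def\<close>)
  qed
  have "closed K"
  proof -
    have "K = {r. 0 \<le> r} \<inter> {r. delta V x r \<le> 1} \<inter> {r. N r \<le> (1 - delta V x r) * H r}"
      using K_iff by auto
    also have "closed \<dots>"
      unfolding N_def H_def delta_def
      by (intro closed_Int closed_Collect_le continuous_intros)
    finally show ?thesis .
  qed
  moreover have "K \<subseteq> {0 .. \<bar>2 * m * \<gamma> - b\<bar> / (2 * m * V)}"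
  proof
    fix r assume r: "r \<in> K"
    then have r0: "0 \<le> r" "delta V x r < 1" by (auto simp: K_def)
    have "0 \<le> N r" using V x m by (simp add: N_def)
    with r K_iff[of r] have "0 \<le> (1 - delta V x r) * H r" by simp
    then have "0 \<le> H r" using r0 by (simp add: zero_le_mult_iff)
    moreover have "m * V * (2 * r\<^sup>2) \<le> m * V * (exp (2 * r) - 1 - 2 * r)"
      using exp_lower_Taylor_quadratic[of "2 * r"] r0 V m
      by (intro mult_left_mono) (auto simp: power2_eq_square)
    ultimately have "r * (2 * m * V * r) \<le> r * (2 * m * \<gamma> - b)"
      by (simp add: H_def power2_eq_square algebra_simps)
    also have "\<dots> \<le> r * \<bar>2 * m * \<gamma> - b\<bar>" using r0 by (intro mult_left_mono) auto
    finally have "2 * m * V * r \<le> \<bar>2 * m * \<gamma> - b\<bar>"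
      using r0 by (cases "r = 0") auto
    then show "r \<in> {0 .. \<bar>2 * m * \<gamma> - b\<bar> / (2 * m * V)}"
      using r0 V m by (simp add: field_simps)
  qed
  ultimately have "compact K"
    using bounded_subset[OF bounded_closed_interval] compact_eq_bounded_closed by blast
  moreover have zero: "0 \<in> K" using x by (simp add: K_def delta_def exponent_def Delta_def)
  moreover have "continuous_on K (exponent V x m b \<gamma>)"
    unfolding exponent_def Delta_def delta_def
    by (intro continuous_intros) (auto simp: K_def delta_def)
  ultimately obtain r0 where r0: "r0 \<in> K" "\<And>r. r \<in> K \<Longrightarrow> exponent V x m b \<gamma> r0 \<le> exponent V x m b \<gamma> r"
    using continuous_attains_inf[of K] by blast
  show thesis
  proof (rule that)
    show "0 \<le> r0" "delta V x r0 < 1" using r0(1) by (auto simp: K_def)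
    fix r assume "0 \<le> r" "delta V x r < 1"
    moreover have "exponent V x m b \<gamma> r0 \<le> 0" using r0(1) by (simp add: K_def)
    ultimately show "exponent V x m b \<gamma> r0 \<le> exponent V x m b \<gamma> r"
      using r0(2)[of r] by (cases "r \<in> K") (auto simp: K_def)
  qed
qed

text \<open>
  For \<open>x = 1\<close> the only admissible parameter is \<open>r = 0\<close>, where the bound is infinite. This case
  does occur: \<open>spec_beta\<close> is \<open>1\<close> on bipartite graphs.
\<close>

lemma ex_arg_min_exp_bound:
  assumes V: "0 < V" and x: "0 \<le> x" "x \<le> 1" and m: "0 < m" and c: "0 \<le> c"
    and g: "\<And>r. g r = (if delta V x r = 1 then \<infinity> else ereal (c * exp (exponent V x m b \<gamma> r)))"
    and p: "\<And>r. 0 \<le> r \<Longrightarrow> delta V x r < 1 \<Longrightarrow> p \<le> c * exp (exponent V x m b \<gamma> r)"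
  shows "\<exists>r0. is_arg_min g (\<lambda>r. 0 \<le> r \<and> delta V x r \<le> 1) r0 \<and> ereal p \<le> g r0"
proof (cases "x = 1")
  case True
  have "g r = \<infinity>" if "0 \<le> r" "delta V x r \<le> 1" for r
  proof -
    have "exp (2 * r) + V * (exp r - 1)\<^sup>2 \<le> 1" using that True by (simp add: delta_def)
    moreover have "V * (exp r - 1)\<^sup>2 \<ge> 0" using V by simp
    ultimately have "exp (2 * r) \<le> 1" by linarith
    then have "r = 0" using that by simp
    then show ?thesis using True by (simp add: g delta_def)
  qed
  moreover have "delta V x 0 = 1" using True by (simp add: delta_def)
  ultimately show ?thesis
    by (intro exI[of _ 0]) (auto simp: is_arg_min_def g)
next
  case False
  then have "x < 1" using x by simp
  obtain r0 where r0: "0 \<le> r0" "delta V x r0 < 1"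
    "\<And>r. 0 \<le> r \<Longrightarrow> delta V x r < 1 \<Longrightarrow> exponent V x m b \<gamma> r0 \<le> exponent V x m b \<gamma> r"
    using exponent_attains_min[OF V x(1) \<open>x < 1\<close> m] by blast
  have "g r0 \<le> g r" if "0 \<le> r" "delta V x r \<le> 1" for r
    using that r0 c by (auto simp: g mult_left_mono)
  then show ?thesis
    using r0 p[OF r0(1,2)] by (intro exI[of _ r0]) (auto simp: is_arg_min_def g not_less)
qed

section \<open>Symmetrisation and spectrum of a reversible chain\<close>

text \<open>
  The maximum principle: the average over the neighbours of a point where \<open>h\<close> is maximal equals the
  maximum only if \<open>h\<close> is maximal at every neighbour, and every state is reached along neighbours.
\<close>

lemma harmonic_imp_constant:
  fixes P :: "real ^ 'v ^ 'v::finite"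
  assumes nonneg: "\<And>i j. 0 \<le> P $ i $ j" and col: "\<And>j. (\<Sum>i\<in>UNIV. P $ i $ j) = 1"
    and irred: "\<And>i j. (j, i) \<in> {(u, v). P $ v $ u > 0}\<^sup>*"
    and harm: "\<And>j. h j = (\<Sum>i\<in>UNIV. P $ i $ j * h i)"
  shows "h i = h j"
proof -
  define m where "m = Max (range h)"
  have m: "h i \<le> m" for i by (simp add: m_def)
  have "m \<in> range h" unfolding m_def by (rule Max_in) auto
  then obtain a where a: "h a = m" by auto
  have "h i = m" for i
    using irred[of a i]
  proof (induction rule: rtrancl_induct)
    case base
    show ?case by (rule a)
  next
    case (step b c)
    have "(\<Sum>i\<in>UNIV. P $ i $ b * (m - h i)) = m * (\<Sum>i\<in>UNIV. P $ i $ b) - (\<Sum>i\<in>UNIV. P $ i $ b * h i)"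
      by (simp add: algebra_simps sum_subtractf sum_distrib_left)
    also have "\<dots> = 0" using col[of b] harm[of b] step.IH by simp
    finally have "P $ c $ b * (m - h c) = 0"
      by (subst (asm) sum_nonneg_eq_0_iff) (auto simp: nonneg m)
    then show ?case using step.hyps by auto
  qed
  then show ?thesis by simp
qed

locale reversible_chain =
  fixes P :: "real ^ 'v ^ 'v::finite" and s :: "real ^ 'v"
  assumes nonneg: "\<And>i j. 0 \<le> P $ i $ j"
    and col_sum: "\<And>j. (\<Sum>i\<in>UNIV. P $ i $ j) = 1"
    and irreducible: "\<And>i j. (j, i) \<in> {(u, v). P $ v $ u > 0}\<^sup>*"
    and s_pos: "\<And>i. 0 < s $ i"
    and s_sum: "(\<Sum>i\<in>UNIV. s $ i) = 1"
    and detailed_balance: "\<And>i j. s $ j * P $ i $ j = s $ i * P $ j $ i"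
begin

definition sqrt_s :: "real ^ 'v" where
  "sqrt_s = (\<chi> i. sqrt (s $ i))"

text \<open>
  The matrix \<open>D^(-1/2) P D^(1/2)\<close> with \<open>D = diag s\<close>, as an operator. It is similar to \<open>P\<close>, and
  by detailed balance it is symmetric.
\<close>

definition symm :: "real ^ 'v \<Rightarrow> real ^ 'v" where
  "symm v = (\<chi> i. \<Sum>j\<in>UNIV. P $ i $ j * (sqrt (s $ j) / sqrt (s $ i)) * v $ j)"

lemma symm_entry: "P $ i $ j * (sqrt (s $ j) / sqrt (s $ i)) = P $ j $ i * (sqrt (s $ i) / sqrt (s $ j))"
proof -
  define a where "a = (\<lambda>k. sqrt (s $ k))"
  have "a k \<noteq> 0" "s $ k = a k * a k" for k using s_pos[of k] by (simp_all add: a_def)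
  then show ?thesis
    using detailed_balance[of j i] unfolding a_def[symmetric] by (simp add: frac_eq_eq mult_ac)
qed

lemma linear_symm: "linear symm"
proof (rule linearI)
  show "symm (v + w) = symm v + symm w" for v w
    by (simp add: symm_def vec_eq_iff distrib_left sum.distrib)
  show "symm (c *\<^sub>R v) = c *\<^sub>R symm v" for c v
    by (simp add: symm_def vec_eq_iff sum_distrib_left mult_ac)
qed

lemma symm_self_adjoint: "symm v \<bullet> w = v \<bullet> symm w"
proof -
  have "symm v \<bullet> w = (\<Sum>i\<in>UNIV. \<Sum>j\<in>UNIV. P $ i $ j * (sqrt (s $ j) / sqrt (s $ i)) * (v $ j * w $ i))"
    by (simp add: symm_def inner_vec_def sum_distrib_right mult.assoc)
  also have "\<dots> = (\<Sum>j\<in>UNIV. \<Sum>i\<in>UNIV. P $ i $ j * (sqrt (s $ j) / sqrt (s $ i)) * (v $ j * w $ i))"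
    by (rule sum.swap)
  also have "\<dots> = (\<Sum>j\<in>UNIV. \<Sum>i\<in>UNIV. P $ j $ i * (sqrt (s $ i) / sqrt (s $ j)) * (v $ j * w $ i))"
    by (intro sum.cong refl arg_cong2[where f = "(*)"] symm_entry)
  also have "\<dots> = v \<bullet> symm w"
    by (simp add: symm_def inner_vec_def sum_distrib_left mult_ac)
  finally show ?thesis .
qed

lemma norm_sqrt_s: "norm sqrt_s = 1"
proof -
  have "(norm sqrt_s)\<^sup>2 = 1"
    unfolding norm_sq_vec using s_sum s_pos by (simp add: sqrt_s_def less_imp_le)
  then show ?thesis using norm_ge_zero[of sqrt_s] unfolding power2_eq_1_iff by linarith
qed

text \<open>
  Because of its symmetry, \<^const>\<open>symm\<close> is also similar to the transpose of \<open>P\<close>, the operator that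
  averages a function over the next step of the chain.
\<close>

lemma symm_transposed:
  "symm (\<chi> i. sqrt (s $ i) * h i) = (\<chi> j. sqrt (s $ j) * (\<Sum>i\<in>UNIV. P $ i $ j * h i))"
proof -
  have "P $ j $ i * (sqrt (s $ i) / sqrt (s $ j)) * (sqrt (s $ i) * h i) = sqrt (s $ j) * (P $ i $ j * h i)" for i j
    unfolding symm_entry[of j i] using s_pos[of i] by simp
  then show ?thesis by (simp add: symm_def sum_distrib_left)
qed

lemma symm_sqrt_s: "symm sqrt_s = sqrt_s"
  using symm_transposed[of "\<lambda>_. 1"] by (simp add: col_sum sqrt_s_def)

lemma matrix_mult_sqrt: "P *v (\<chi> i. sqrt (s $ i) * v $ i) = (\<chi> i. sqrt (s $ i) * symm v $ i)"
proof -
  have "sqrt (s $ i) \<noteq> 0" for i using s_pos[of i] by auto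
  then show ?thesis
    by (simp add: matrix_vector_mult_def symm_def vec_eq_iff sum_distrib_left mult_ac)
qed

lemma symm_eigen_iff:
  "P *v (\<chi> i. sqrt (s $ i) * v $ i) = l *\<^sub>R (\<chi> i. sqrt (s $ i) * v $ i) \<longleftrightarrow> symm v = l *\<^sub>R v"
proof -
  have "sqrt (s $ i) \<noteq> 0" for i using s_pos[of i] by auto
  then show ?thesis unfolding matrix_mult_sqrt by (auto simp: vec_eq_iff)
qed

lemma eigenvalues_eq: "eigenvalues P = {l. \<exists>v. v \<noteq> 0 \<and> symm v = l *\<^sub>R v}"
proof -
  have nz: "sqrt (s $ i) \<noteq> 0" for i using s_pos[of i] by auto
  have "l \<in> eigenvalues P \<longleftrightarrow> (\<exists>v. v \<noteq> 0 \<and> symm v = l *\<^sub>R v)" for l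
  proof
    assume "l \<in> eigenvalues P"
    then obtain w where w: "w \<noteq> 0" "P *v w = l *\<^sub>R w" by (auto simp: eigenvalues_def)
    define v where "v = (\<chi> i. w $ i / sqrt (s $ i))"
    have "(\<chi> i. sqrt (s $ i) * v $ i) = w" using nz by (simp add: v_def vec_eq_iff)
    with w symm_eigen_iff[of v l] have "symm v = l *\<^sub>R v" by simp
    moreover have "v \<noteq> 0" using w(1) nz by (auto simp: v_def vec_eq_iff)
    ultimately show "\<exists>v. v \<noteq> 0 \<and> symm v = l *\<^sub>R v" by blast
  next
    assume "\<exists>v. v \<noteq> 0 \<and> symm v = l *\<^sub>R v"
    then obtain v where v: "v \<noteq> 0" "symm v = l *\<^sub>R v" by blast
    have "(\<chi> i. sqrt (s $ i) * v $ i) \<noteq> 0" using v(1) nz by (auto simp: vec_eq_iff)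
    with v symm_eigen_iff[of v l] show "l \<in> eigenvalues P" unfolding eigenvalues_def by blast
  qed
  then show ?thesis by auto
qed

text \<open>
  Eigenvectors of a self-adjoint operator for distinct eigenvalues are orthogonal, hence
  independent.
\<close>

lemma finite_eigenvalues: "finite (eigenvalues P)"
proof -
  define e where "e = (\<lambda>l. SOME v. v \<noteq> 0 \<and> symm v = l *\<^sub>R v)"
  have "e l \<noteq> 0 \<and> symm (e l) = l *\<^sub>R e l" if "l \<in> eigenvalues P" for l
    using that unfolding e_def eigenvalues_eq mem_Collect_eq by (rule someI_ex)
  then have e: "e l \<noteq> 0" "symm (e l) = l *\<^sub>R e l" if "l \<in> eigenvalues P" for l
    using that by blast+
  have "inj_on e (eigenvalues P)"
    by (rule inj_onI) (metis e scaleR_right_imp_eq)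
  moreover have "independent (e ` eigenvalues P)"
  proof (rule pairwise_orthogonal_independent)
    have "e l \<bullet> e k = 0" if "l \<in> eigenvalues P" "k \<in> eigenvalues P" "l \<noteq> k" for l k
      using symm_self_adjoint[of "e l" "e k"] that by (simp add: e)
    then show "pairwise orthogonal (e ` eigenvalues P)"
      unfolding pairwise_def orthogonal_def by blast
    show "0 \<notin> e ` eigenvalues P" using e(1) by force
  qed
  then have "finite (e ` eigenvalues P)" by (rule independent_imp_finite)
  ultimately show ?thesis by (simp add: finite_image_iff)
qed

text \<open>
  A matrix with non-negative entries and column sums \<open>1\<close> does not increase the sum of the absolute
  values of the entries of a vector.
\<close>

lemma abs_eigenvalue_le_1: "\<bar>l\<bar> \<le> 1" if l: "l \<in> eigenvalues P"
proof -
  obtain v where v: "v \<noteq> 0" "P *v v = l *\<^sub>R v" using l by (auto simp: eigenvalues_def)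
  have "\<bar>l\<bar> * (\<Sum>i\<in>UNIV. \<bar>v $ i\<bar>) = (\<Sum>i\<in>UNIV. \<bar>(P *v v) $ i\<bar>)"
    by (simp add: v(2) abs_mult sum_distrib_left)
  also have "\<dots> \<le> (\<Sum>i\<in>UNIV. \<Sum>j\<in>UNIV. P $ i $ j * \<bar>v $ j\<bar>)"
    unfolding matrix_vector_mult_def
    by (intro sum_mono) (use nonneg in \<open>auto intro!: order.trans[OF sum_abs] sum_mono simp: abs_mult\<close>)
  also have "\<dots> = (\<Sum>j\<in>UNIV. (\<Sum>i\<in>UNIV. P $ i $ j) * \<bar>v $ j\<bar>)"
    unfolding sum_distrib_right by (rule sum.swap)
  also have "\<dots> = (\<Sum>j\<in>UNIV. \<bar>v $ j\<bar>)" by (simp add: col_sum)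
  finally have "\<bar>l\<bar> * (\<Sum>i\<in>UNIV. \<bar>v $ i\<bar>) \<le> (\<Sum>j\<in>UNIV. \<bar>v $ j\<bar>)" .
  moreover obtain k where "v $ k \<noteq> 0" using v(1) by (auto simp: vec_eq_iff)
  then have "(\<Sum>i\<in>UNIV. \<bar>v $ i\<bar>) > 0" by (intro sum_pos2[of _ k]) auto
  ultimately show ?thesis by simp
qed

text \<open>
  Simplicity of the eigenvalue \<open>1\<close>: an eigenvector for it corresponds to a harmonic function, which
  is constant, so the vector is a multiple of \<^const>\<open>sqrt_s\<close>. Thus the whole spectrum on the
  orthogonal complement lies in the set over which \<^const>\<open>second_eigenvalue\<close> and \<^const>\<open>spec_beta\<close>
  take their maxima.
\<close>

lemma orthogonal_eigenvalue:
  assumes v: "v \<noteq> 0" "sqrt_s \<bullet> v = 0" "symm v = l *\<^sub>R v"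
  shows "l \<in> eigenvalues P - {1}"
proof -
  have "l \<noteq> 1"
  proof
    assume "l = 1"
    define h where "h = (\<lambda>i. v $ i / sqrt (s $ i))"
    have nz: "sqrt (s $ i) \<noteq> 0" for i using s_pos[of i] by auto
    have vh: "v = (\<chi> i. sqrt (s $ i) * h i)" using nz by (simp add: h_def vec_eq_iff)
    have "(\<chi> j. sqrt (s $ j) * (\<Sum>i\<in>UNIV. P $ i $ j * h i)) = (\<chi> i. sqrt (s $ i) * h i)"
      using v(3) \<open>l = 1\<close> symm_transposed[of h] unfolding vh by simp
    then have "h j = (\<Sum>i\<in>UNIV. P $ i $ j * h i)" for j
      using nz by (simp add: vec_eq_iff)
    then have const: "h i = h undefined" for i
      using harmonic_imp_constant[OF nonneg col_sum irreducible] by blast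
    have "v = h undefined *\<^sub>R sqrt_s"
      unfolding vh using const by (simp add: vec_eq_iff sqrt_s_def)
    then have "sqrt_s \<bullet> v = h undefined" using norm_sqrt_s
      by (metis inner_scaleR_right dot_square_norm mult.right_neutral power_one)
    with v(1,2) \<open>v = h undefined *\<^sub>R sqrt_s\<close> show False by force
  qed
  then show ?thesis using v by (auto simp: eigenvalues_eq)
qed

lemma quadratic_form_symm_le: "v \<bullet> symm v \<le> gap_form sqrt_s (spec_alpha P) v"
proof (rule quadratic_form_le_gap_form[OF linear_symm symm_self_adjoint norm_sqrt_s symm_sqrt_s])
  fix \<mu> and v :: "real ^ 'v"
  assume "v \<noteq> 0" "sqrt_s \<bullet> v = 0" "symm v = \<mu> *\<^sub>R v"
  then have "\<mu> \<le> second_eigenvalue P"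
    unfolding second_eigenvalue_def using orthogonal_eigenvalue finite_eigenvalues
    by (intro Max_ge) auto
  then show "\<mu> \<le> spec_alpha P" by (simp add: spec_alpha_def)
qed

lemma norm_symm_sq_le: "(norm (symm v))\<^sup>2 \<le> gap_form sqrt_s ((spec_beta P)\<^sup>2) v"
proof (rule norm_sq_le_gap_form[OF linear_symm symm_self_adjoint norm_sqrt_s symm_sqrt_s])
  fix \<mu> and v :: "real ^ 'v"
  assume "v \<noteq> 0" "sqrt_s \<bullet> v = 0" "symm v = \<mu> *\<^sub>R v"
  then show "\<bar>\<mu>\<bar> \<le> spec_beta P"
    unfolding spec_beta_def using orthogonal_eigenvalue finite_eigenvalues
    by (intro Max_ge) blast+
qed

text \<open>
  With the set nonempty, the \<^const>\<open>Max\<close> in \<^const>\<open>second_eigenvalue\<close> and \<^const>\<open>spec_beta\<close> is a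
  genuine maximum.
\<close>

lemma nontrivial_eigenvalues:
  assumes "z \<noteq> 0" "sqrt_s \<bullet> z = 0"
  shows "eigenvalues P - {1} \<noteq> {}"
proof -
  define W where "W = {w. sqrt_s \<bullet> w = 0}"
  have W: "subspace W" unfolding W_def by (rule subspace_hyperplane)
  have "W \<noteq> {0}" using assms by (auto simp: W_def)
  moreover have "symm w \<in> W" if "w \<in> W" for w
    using that symm_self_adjoint[of sqrt_s w] by (simp add: W_def symm_sqrt_s)
  ultimately obtain \<mu> v where v: "v \<in> W" "norm v = 1" "symm v = \<mu> *\<^sub>R v"
    using self_adjoint_max_eigenvector[OF linear_symm symm_self_adjoint W] by metis
  then have "v \<noteq> 0" by auto
  with v orthogonal_eigenvalue[of v \<mu>] show ?thesis by (auto simp: W_def)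
qed

lemma spec_alpha_bounds:
  assumes "eigenvalues P - {1} \<noteq> {}"
  shows "0 \<le> spec_alpha P" "spec_alpha P < 1"
proof -
  have "second_eigenvalue P \<in> eigenvalues P - {1}"
    unfolding second_eigenvalue_def using finite_eigenvalues assms by (intro Max_in) auto
  with abs_eigenvalue_le_1[of "second_eigenvalue P"] show "0 \<le> spec_alpha P" "spec_alpha P < 1"
    by (auto simp: spec_alpha_def)
qed

lemma spec_beta_bounds:
  assumes "eigenvalues P - {1} \<noteq> {}"
  shows "0 \<le> spec_beta P" "spec_beta P \<le> 1"
proof -
  have "spec_beta P \<in> abs ` (eigenvalues P - {1})"
    unfolding spec_beta_def using finite_eigenvalues assms by (intro Max_in) auto
  with abs_eigenvalue_le_1 show "0 \<le> spec_beta P" "spec_beta P \<le> 1" by auto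
qed

subsection \<open>Growth of the weighted iterates\<close>

definition twisted :: "real \<Rightarrow> ('v \<Rightarrow> real) \<Rightarrow> real ^ 'v \<Rightarrow> real ^ 'v" where
  "twisted t f v = symm (tilt t f v)"

context
  fixes f :: "'v \<Rightarrow> real" and V :: real
  assumes f_le: "\<And>i. \<bar>f i\<bar> \<le> 1" and f_mean: "(\<Sum>i\<in>UNIV. f i * s $ i) = 0"
    and V_eq: "V = (\<Sum>i\<in>UNIV. (f i)\<^sup>2 * s $ i)"
begin

lemma gap_form_tilt_le_exp:
  assumes "0 \<le> x" "0 \<le> r" "delta V x r < 1"
  shows "gap_form sqrt_s x (tilt r f v)
    \<le> exp (V * (exp (2 * r) - 1 - 2 * r + Delta V x r)) * (norm v)\<^sup>2"
proof -
  have sq: "(sqrt_s $ i)\<^sup>2 = s $ i" for i using s_pos[of i] by (simp add: sqrt_s_def)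
  have V: "0 \<le> V" unfolding V_eq using s_pos by (intro sum_nonneg) (simp add: less_imp_le)
  then have "x * (V * (exp r - 1)\<^sup>2) \<ge> 0" using assms by simp
  then have "x * exp (2 * r) < 1" using assms(3) by (simp add: delta_def algebra_simps)
  then have "gap_form sqrt_s x (tilt r f v) \<le> tilt_growth V x r * (norm v)\<^sup>2"
    using assms f_le f_mean V_eq by (intro gap_form_tilt_le norm_sqrt_s) (simp_all add: sq)
  also have "\<dots> \<le> exp (V * (exp (2 * r) - 1 - 2 * r + Delta V x r)) * (norm v)\<^sup>2"
    using assms V by (intro mult_right_mono tilt_growth_le_exp) auto
  finally show ?thesis .
qed

lemma norm_twisted_le_beta:
  assumes "0 \<le> r" "delta V ((spec_beta P)\<^sup>2) r < 1"
  shows "norm ((twisted r f ^^ n) sqrt_s)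
    \<le> exp (real n / 2 * (V * (exp (2 * r) - 1 - 2 * r + Delta V ((spec_beta P)\<^sup>2) r)))"
proof -
  define K where "K = V * (exp (2 * r) - 1 - 2 * r + Delta V ((spec_beta P)\<^sup>2) r)"
  have step: "norm (twisted r f v) \<le> exp (K / 2) * norm v" for v
  proof (rule power2_le_imp_le)
    have "(norm (twisted r f v))\<^sup>2 \<le> gap_form sqrt_s ((spec_beta P)\<^sup>2) (tilt r f v)"
      unfolding twisted_def by (rule norm_symm_sq_le)
    also have "\<dots> \<le> exp K * (norm v)\<^sup>2"
      unfolding K_def using assms by (intro gap_form_tilt_le_exp) auto
    also have "\<dots> = (exp (K / 2) * norm v)\<^sup>2"
      by (simp add: power_mult_distrib flip: exp_double)
    finally show "(norm (twisted r f v))\<^sup>2 \<le> (exp (K / 2) * norm v)\<^sup>2" .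
  qed simp
  have "norm ((twisted r f ^^ n) sqrt_s) \<le> exp (real n * (K / 2))"
  proof (induction n)
    case (Suc n)
    have "norm ((twisted r f ^^ Suc n) sqrt_s) \<le> exp (K / 2) * norm ((twisted r f ^^ n) sqrt_s)"
      using step by simp
    also have "\<dots> \<le> exp (K / 2) * exp (real n * (K / 2))" using Suc by simp
    finally show ?case by (simp add: exp_add[symmetric] algebra_simps add_divide_distrib)
  qed (simp add: norm_sqrt_s)
  then show ?thesis by (simp add: K_def)
qed

text \<open>
  Half of the weight \<open>exp (2 r f)\<close> is moved to the other side of \<^const>\<open>symm\<close>: the iterates of
  \<open>twisted (2 * r) f\<close> are conjugate by \<open>tilt r f\<close> to those of a self-adjoint operator with non-negative
  entries. The conjugation and its inverse each cost a factor \<open>exp r\<close>.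
\<close>

lemma norm_twisted_le_alpha:
  assumes "0 \<le> r" "delta V (spec_alpha P) r < 1"
  shows "norm ((twisted (2 * r) f ^^ n) sqrt_s)
    \<le> exp (2 * r) * exp (real n * (V * (exp (2 * r) - 1 - 2 * r + Delta V (spec_alpha P) r)))"
proof -
  define K where "K = V * (exp (2 * r) - 1 - 2 * r + Delta V (spec_alpha P) r)"
  define T where "T = (\<lambda>v. tilt r f (symm (tilt r f v)))"
  have inverse: "tilt r (\<lambda>i. - f i) (tilt r f v) = v" for v
    by (simp add: tilt_def vec_eq_iff flip: mult.assoc exp_add)
  have double: "tilt r f (tilt r f v) = tilt (2 * r) f v" for v
    by (simp add: tilt_def vec_eq_iff flip: mult.assoc exp_add)
  have step: "norm (T v) \<le> exp K * norm v" for v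
  proof (rule norm_le_of_nonneg_self_adjoint)
    have "linear (tilt r f \<circ> symm \<circ> tilt r f)" by (intro linear_compose linear_tilt linear_symm)
    then show "linear T" by (simp add: T_def o_def)
    show "T y \<bullet> w = y \<bullet> T w" for y w by (simp add: T_def tilt_self_adjoint symm_self_adjoint)
    show "\<bar>T y $ i\<bar> \<le> T (\<chi> j. \<bar>y $ j\<bar>) $ i" for y i
      unfolding T_def tilt_def symm_def
      by (simp add: abs_mult) (use nonneg s_pos in
        \<open>auto intro!: order.trans[OF sum_abs] sum_mono simp: abs_mult less_imp_le abs_of_pos\<close>)
    show "y \<bullet> T y \<le> exp K * (norm y)\<^sup>2" for y
    proof -
      have "y \<bullet> T y = tilt r f y \<bullet> symm (tilt r f y)"
        by (simp add: T_def tilt_self_adjoint)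
      also have "\<dots> \<le> gap_form sqrt_s (spec_alpha P) (tilt r f y)" by (rule quadratic_form_symm_le)
      also have "\<dots> \<le> exp K * (norm y)\<^sup>2"
        unfolding K_def using assms by (intro gap_form_tilt_le_exp) (auto simp: spec_alpha_def)
      finally show ?thesis .
    qed
  qed
  have conj: "tilt r f ((twisted (2 * r) f ^^ n) sqrt_s) = (T ^^ n) (tilt r f sqrt_s)" for n
    by (induction n) (simp_all add: T_def twisted_def flip: double)
  have "norm ((T ^^ n) (tilt r f sqrt_s)) \<le> exp (real n * K) * exp r"
  proof (induction n)
    case 0
    show ?case using norm_tilt_le[of r f sqrt_s] assms(1) f_le norm_sqrt_s by simp
  next
    case (Suc n)
    have "norm ((T ^^ Suc n) (tilt r f sqrt_s)) \<le> exp K * norm ((T ^^ n) (tilt r f sqrt_s))"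
      using step by simp
    also have "\<dots> \<le> exp K * (exp (real n * K) * exp r)" using Suc by simp
    finally show ?case by (simp add: exp_add[symmetric] algebra_simps)
  qed
  note growth = this
  have "norm ((twisted (2 * r) f ^^ n) sqrt_s)
      = norm (tilt r (\<lambda>i. - f i) ((T ^^ n) (tilt r f sqrt_s)))"
    by (simp add: inverse flip: conj)
  also have "\<dots> \<le> exp r * norm ((T ^^ n) (tilt r f sqrt_s))"
    using assms(1) f_le by (intro norm_tilt_le) auto
  also have "\<dots> \<le> exp r * (exp (real n * K) * exp r)" using growth by simp
  also have "\<dots> = exp (2 * r) * exp (real n * K)" by (simp add: exp_add[symmetric] algebra_simps)
  finally show ?thesis by (simp add: K_def)
qed

end

end

section \<open>Random walks on connected weighted graphs are reversible chains\<close>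

text \<open>
  The stationary distribution is found from the maximum principle: it must be proportional to the
  weighted degree, which gives both its positivity and detailed balance. A second vertex is needed
  to make all degrees positive.
\<close>

lemma reversible_chain_of_graph:
  fixes w :: "'v::finite \<Rightarrow> 'v \<Rightarrow> real" and i0 j0 :: 'v
  assumes w: "connected_weighted_graph w" and P: "P = transition_matrix w"
    and s: "stationary_distribution P s" and two: "i0 \<noteq> j0"
  shows "reversible_chain P s"
proof -
  have w0: "w i j \<ge> 0" and w_sym: "w i j = w j i" and conn: "(i, j) \<in> {(u, v). w u v > 0}\<^sup>*" for i j
    using w by (auto simp: connected_weighted_graph_def)
  define d where "d = (\<lambda>j. \<Sum>k\<in>UNIV. w j k)"
  have d: "d j > 0" for j
  proof -
    obtain i where "i \<noteq> j" using two by metis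
    with conn[of j i] obtain k where "w j k > 0" by (auto elim: converse_rtranclE)
    then show ?thesis unfolding d_def using w0 by (intro sum_pos2[of _ k]) auto
  qed
  have Pw: "P $ i $ j = w j i / d j" for i j by (simp add: P transition_matrix_def d_def)
  have nonneg: "0 \<le> P $ i $ j" for i j using w0 d[of j] by (simp add: Pw less_imp_le)
  have col: "(\<Sum>i\<in>UNIV. P $ i $ j) = 1" for j
    using d[of j] by (simp add: Pw sum_divide_distrib[symmetric]) (simp add: d_def)
  have "{(u, v). P $ v $ u > 0} = {(u, v). w u v > 0}"
    using d by (auto simp: Pw zero_less_divide_iff dest: less_asym)
  then have irred: "(j, i) \<in> {(u, v). P $ v $ u > 0}\<^sup>*" for i j using conn by simp
  have s_sum: "(\<Sum>i\<in>UNIV. s $ i) = 1" and Ps: "P *v s = s"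
    using s by (auto simp: stationary_distribution_def prob_vector_def)
  \<comment> \<open>By the symmetry of the weights, stationarity of \<open>s\<close> says that \<open>s / d\<close> is harmonic.\<close>
  define h where "h = (\<lambda>j. s $ j / d j)"
  have sh: "s $ j = d j * h j" for j using d[of j] by (simp add: h_def)
  have "h i = (\<Sum>j\<in>UNIV. P $ j $ i * h j)" for i
  proof -
    have "s $ i = (\<Sum>j\<in>UNIV. P $ i $ j * s $ j)"
      by (subst Ps[symmetric]) (simp add: matrix_vector_mult_def)
    also have "\<dots> = (\<Sum>j\<in>UNIV. w i j * h j)"
      using d by (simp add: Pw sh w_sym[of _ i] less_imp_neq[symmetric])
    finally show ?thesis
      by (simp add: h_def Pw sum_divide_distrib mult_ac)
  qed
  from harmonic_imp_constant[OF nonneg col irred this]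
  have const: "h i = h i0" for i by blast
  define c where "c = h i0"
  have sc: "s $ j = c * d j" for j using sh[of j] const[of j] by (simp add: c_def)
  have "c * (\<Sum>j\<in>UNIV. d j) = 1" using s_sum by (simp add: sc sum_distrib_left)
  moreover have "(\<Sum>j\<in>UNIV. d j) > 0" using d by (simp add: sum_pos)
  ultimately have c: "c > 0" by (metis zero_less_mult_pos2 zero_less_one)
  show ?thesis
  proof
    show "0 < s $ i" for i using c d by (simp add: sc)
    show "s $ j * P $ i $ j = s $ i * P $ j $ i" for i j
      using d[of i] d[of j] w_sym[of i j] by (simp add: sc Pw)
  qed (fact nonneg col irred s_sum)+
qed

section \<open>Exponential moments along the walk\<close>

text \<open>
  The backward operator of the walk, weighted by \<open>exp (t f)\<close> at the state entered.
\<close>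

definition transfer :: "real ^ 'v ^ 'v \<Rightarrow> real \<Rightarrow> ('v \<Rightarrow> real) \<Rightarrow> ('v \<Rightarrow> real) \<Rightarrow> 'v::finite \<Rightarrow> real" where
  "transfer P t f h j = (\<Sum>i\<in>UNIV. P $ i $ j * (exp (t * f i) * h i))"

context
  fixes M :: "'a measure" and P :: "real ^ 'v ^ 'v" and q :: "real ^ 'v::finite"
    and X :: "nat \<Rightarrow> 'a \<Rightarrow> 'v"
  assumes walk: "random_walk M P q X"
begin

interpretation prob_space M
  using walk by (simp add: random_walk_def)

lemma X_measurable [measurable]: "X k \<in> measurable M (count_space UNIV)"
  using walk by (simp add: random_walk_def)

text \<open>
  Conditional probabilities are specified only for histories of positive probability; for the others
  both sides vanish.
\<close>

lemma path_prob_Suc: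
  "\<P>(\<omega> in M. \<forall>k\<le>Suc n. X k \<omega> = x k) = P $ x (Suc n) $ x n * \<P>(\<omega> in M. \<forall>k\<le>n. X k \<omega> = x k)"
proof -
  have eq: "(\<forall>k\<le>Suc n. X k \<omega> = x k) \<longleftrightarrow> X (Suc n) \<omega> = x (Suc n) \<and> (\<forall>k\<le>n. X k \<omega> = x k)" for \<omega>
    by (auto simp: le_Suc_eq)
  show ?thesis
  proof (cases "\<P>(\<omega> in M. \<forall>k\<le>n. X k \<omega> = x k) > 0")
    case True
    then have "\<P>(\<omega> in M. X (Suc n) \<omega> = x (Suc n) \<bar> \<forall>k\<le>n. X k \<omega> = x k) = P $ x (Suc n) $ x n"
      using walk by (simp add: random_walk_def)
    then show ?thesis using True unfolding eq cond_prob_def by (simp add: field_simps)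
  next
    case False
    then have "\<P>(\<omega> in M. \<forall>k\<le>n. X k \<omega> = x k) = 0" using zero_less_measure_iff by blast
    moreover have "\<P>(\<omega> in M. \<forall>k\<le>Suc n. X k \<omega> = x k) \<le> \<P>(\<omega> in M. \<forall>k\<le>n. X k \<omega> = x k)"
      by (intro finite_measure_mono) auto
    ultimately show ?thesis by (simp add: measure_le_0_iff)
  qed
qed

text \<open>
  A function of the first \<open>n + 1\<close> positions takes finitely many values, one for each path.
\<close>

lemma expectation_path:
  fixes G :: "(nat \<Rightarrow> 'v) \<Rightarrow> real"
  assumes G: "\<And>x y. (\<And>k. k \<le> n \<Longrightarrow> x k = y k) \<Longrightarrow> G x = G y"
  shows "integrable M (\<lambda>\<omega>. G (\<lambda>k. X k \<omega>))"
    and "expectation (\<lambda>\<omega>. G (\<lambda>k. X k \<omega>))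
      = (\<Sum>x\<in>PiE {..n} (\<lambda>_. UNIV). G x * \<P>(\<omega> in M. \<forall>k\<le>n. X k \<omega> = x k))"
proof -
  let ?S = "PiE {..n} (\<lambda>_. UNIV :: 'v set)"
  define A where "A = (\<lambda>x. {\<omega> \<in> space M. \<forall>k\<le>n. X k \<omega> = x k})"
  have A: "A x \<in> sets M" for x unfolding A_def by measurable
  have fin: "finite ?S" by (intro finite_PiE) auto
  have eq: "G (\<lambda>k. X k \<omega>) = (\<Sum>x\<in>?S. G x * indicator (A x) \<omega>)" if "\<omega> \<in> space M" for \<omega>
  proof -
    define y where "y = restrict (\<lambda>k. X k \<omega>) {..n}"
    have y: "y \<in> ?S" by (simp add: y_def)
    have "\<omega> \<in> A x \<longleftrightarrow> y = x" if "x \<in> ?S" for x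
    proof
      assume "\<omega> \<in> A x"
      then show "y = x" using that y by (intro PiE_ext[OF y that]) (auto simp: A_def y_def)
    qed (use \<open>\<omega> \<in> space M\<close> in \<open>auto simp: A_def y_def\<close>)
    then have "(\<Sum>x\<in>?S. G x * indicator (A x) \<omega>) = (\<Sum>x\<in>?S. if y = x then G x else 0)"
      by (intro sum.cong refl) (auto simp: indicator_def)
    also have "\<dots> = G y" using y fin by simp
    also have "\<dots> = G (\<lambda>k. X k \<omega>)" by (rule G) (simp add: y_def)
    finally show ?thesis by simp
  qed
  have int: "integrable M (\<lambda>\<omega>. G x * indicator (A x) \<omega>)" for x
    using A by (intro integrable_mult_right integrable_real_indicator) (auto simp: emeasure_eq_measure)
  show "integrable M (\<lambda>\<omega>. G (\<lambda>k. X k \<omega>))"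
    using eq int by (subst Bochner_Integration.integrable_cong[OF refl eq]) auto
  have "expectation (\<lambda>\<omega>. G (\<lambda>k. X k \<omega>)) = expectation (\<lambda>\<omega>. \<Sum>x\<in>?S. G x * indicator (A x) \<omega>)"
    by (intro Bochner_Integration.integral_cong refl eq)
  also have "\<dots> = (\<Sum>x\<in>?S. G x * prob (A x))"
    using int A by (simp add: Int_absorb2 sets.sets_into_space)
  finally show "expectation (\<lambda>\<omega>. G (\<lambda>k. X k \<omega>))
      = (\<Sum>x\<in>?S. G x * \<P>(\<omega> in M. \<forall>k\<le>n. X k \<omega> = x k))"
    by (simp add: A_def)
qed

lemma expectation_markov_step:
  fixes G :: "(nat \<Rightarrow> 'v) \<Rightarrow> real"
  assumes G: "\<And>x y. (\<And>k. k \<le> n \<Longrightarrow> x k = y k) \<Longrightarrow> G x = G y"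
  shows "expectation (\<lambda>\<omega>. G (\<lambda>k. X k \<omega>) * g (X (Suc n) \<omega>))
    = expectation (\<lambda>\<omega>. G (\<lambda>k. X k \<omega>) * (\<Sum>i\<in>UNIV. P $ i $ X n \<omega> * g i))"
proof -
  let ?S = "PiE {..n} (\<lambda>_. UNIV :: 'v set)"
  let ?p = "\<lambda>n x. \<P>(\<omega> in M. \<forall>k\<le>n. X k \<omega> = x k)"
  have "expectation (\<lambda>\<omega>. G (\<lambda>k. X k \<omega>) * g (X (Suc n) \<omega>))
      = (\<Sum>x\<in>PiE (insert (Suc n) {..n}) (\<lambda>_. UNIV). G x * g (x (Suc n)) * ?p (Suc n) x)"
    unfolding atMost_Suc[symmetric]
  proof (rule expectation_path(2)[where G = "\<lambda>x. G x * g (x (Suc n))"])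
    fix x y :: "nat \<Rightarrow> 'v" assume eq: "\<And>k. k \<le> Suc n \<Longrightarrow> x k = y k"
    have "G x = G y" by (rule G) (simp add: eq)
    then show "G x * g (x (Suc n)) = G y * g (y (Suc n))" using eq[of "Suc n"] by simp
  qed
  also have "\<dots> = (\<Sum>(i, y)\<in>UNIV \<times> ?S. G (y(Suc n := i)) * g i * ?p (Suc n) (y(Suc n := i)))"
    unfolding PiE_insert_eq using inj_combinator[of "Suc n" "{..n}" "\<lambda>_. UNIV :: 'v set"]
    by (subst sum.reindex) (auto simp: case_prod_unfold)
  also have "\<dots> = (\<Sum>i\<in>UNIV. \<Sum>y\<in>?S. G y * (P $ i $ y n * g i) * ?p n y)"
  proof (subst sum.cartesian_product[symmetric], intro sum.cong refl)
    fix i y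
    have "G (y(Suc n := i)) = G y" by (rule G) auto
    moreover have "(\<forall>k\<le>n. X k \<omega> = (y(Suc n := i)) k) \<longleftrightarrow> (\<forall>k\<le>n. X k \<omega> = y k)" for \<omega>
      by auto
    then have "?p n (y(Suc n := i)) = ?p n y" by simp
    ultimately show "G (y(Suc n := i)) * g i * ?p (Suc n) (y(Suc n := i)) = G y * (P $ i $ y n * g i) * ?p n y"
      unfolding path_prob_Suc by (simp add: mult_ac)
  qed
  also have "\<dots> = (\<Sum>y\<in>?S. G y * (\<Sum>i\<in>UNIV. P $ i $ y n * g i) * ?p n y)"
    unfolding sum_distrib_left sum_distrib_right by (rule sum.swap)
  also have "\<dots> = expectation (\<lambda>\<omega>. G (\<lambda>k. X k \<omega>) * (\<Sum>i\<in>UNIV. P $ i $ X n \<omega> * g i))"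
  proof (rule expectation_path(2)[where G = "\<lambda>x. G x * (\<Sum>i\<in>UNIV. P $ i $ x n * g i)", symmetric])
    fix x y :: "nat \<Rightarrow> 'v" assume eq: "\<And>k. k \<le> n \<Longrightarrow> x k = y k"
    have "G x = G y" by (rule G) (rule eq)
    then show "G x * (\<Sum>i\<in>UNIV. P $ i $ x n * g i) = G y * (\<Sum>i\<in>UNIV. P $ i $ y n * g i)"
      using eq[of n] by simp
  qed
  finally show ?thesis .
qed

text \<open>
  Induction from the end of the trajectory: integrating out the last position replaces \<open>h\<close> by its
  image under \<^const>\<open>transfer\<close>.
\<close>

lemma expectation_exp_sum:
  "expectation (\<lambda>\<omega>. exp (t * (\<Sum>k=1..n. f (X k \<omega>))) * h (X n \<omega>))
    = (\<Sum>j\<in>UNIV. q $ j * ((transfer P t f ^^ n) h) j)"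
proof (induction n arbitrary: h)
  case 0
  have "expectation (\<lambda>\<omega>. h (X 0 \<omega>)) = expectation (\<lambda>\<omega>. \<Sum>j\<in>UNIV. h j * indicator {\<omega> \<in> space M. X 0 \<omega> = j} \<omega>)"
    by (intro Bochner_Integration.integral_cong refl) (simp add: indicator_def if_distrib sum.delta cong: if_cong)
  also have "\<dots> = (\<Sum>j\<in>UNIV. h j * \<P>(\<omega> in M. X 0 \<omega> = j))"
    by (subst Bochner_Integration.integral_sum) (auto simp: Int_absorb2 emeasure_eq_measure intro!: integrable_real_indicator)
  also have "\<dots> = (\<Sum>j\<in>UNIV. q $ j * h j)"
    using walk by (simp add: random_walk_def mult.commute)
  finally show ?case by simp
next
  case (Suc n)
  let ?G = "\<lambda>x. exp (t * (\<Sum>k=1..n. f (x k)))"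
  have "expectation (\<lambda>\<omega>. exp (t * (\<Sum>k=1..Suc n. f (X k \<omega>))) * h (X (Suc n) \<omega>))
      = expectation (\<lambda>\<omega>. ?G (\<lambda>k. X k \<omega>) * (exp (t * f (X (Suc n) \<omega>)) * h (X (Suc n) \<omega>)))"
    by (simp add: distrib_left exp_add mult_ac)
  also have "\<dots> = expectation (\<lambda>\<omega>. ?G (\<lambda>k. X k \<omega>) * transfer P t f h (X n \<omega>))"
    unfolding transfer_def
    by (rule expectation_markov_step[where G = ?G and g = "\<lambda>i. exp (t * f i) * h i"])
       (intro arg_cong[where f = exp] arg_cong2[where f = "(*)"] sum.cong refl, auto)
  also have "\<dots> = (\<Sum>j\<in>UNIV. q $ j * ((transfer P t f ^^ Suc n) h) j)"
    unfolding Suc.IH by (simp add: funpow_swap1)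
  finally show ?case .
qed

lemma chernoff_bound:
  assumes "0 \<le> t" "1 \<le> n"
  shows "\<P>(\<omega> in M. 1 / real n * (\<Sum>k=1..n. f (X k \<omega>)) > \<gamma>)
    \<le> exp (- (t * \<gamma> * real n)) * (\<Sum>j\<in>UNIV. q $ j * ((transfer P t f ^^ n) (\<lambda>_. 1)) j)"
proof -
  let ?Z = "\<lambda>\<omega>. \<Sum>k=1..n. f (X k \<omega>)"
  let ?E = "{\<omega> \<in> space M. 1 / real n * ?Z \<omega> > \<gamma>}"
  have int: "integrable M (\<lambda>\<omega>. exp (t * ?Z \<omega>))"
    by (rule expectation_path(1)[where G = "\<lambda>x. exp (t * (\<Sum>k=1..n. f (x k)))" and n = n])
       (intro arg_cong[where f = exp] arg_cong2[where f = "(*)"] sum.cong refl, auto)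
  have E: "?E \<in> sets M" by measurable
  have "prob ?E = expectation (indicator ?E)" using E by (simp add: Int_absorb2)
  also have "\<dots> \<le> expectation (\<lambda>\<omega>. exp (- (t * \<gamma> * real n)) * exp (t * ?Z \<omega>))"
  proof (rule integral_mono)
    show "integrable M (indicator ?E :: _ \<Rightarrow> real)" 
      using E by (intro integrable_real_indicator) (auto simp: emeasure_eq_measure)
    show "integrable M (\<lambda>\<omega>. exp (- (t * \<gamma> * real n)) * exp (t * ?Z \<omega>))" using int by simp
    fix \<omega>
    have "1 \<le> exp (- (t * \<gamma> * real n)) * exp (t * ?Z \<omega>)" if "\<omega> \<in> ?E"
    proof -
      have "\<gamma> * real n \<le> ?Z \<omega>" using that assms(2) by (simp add: field_simps)
      from mult_left_mono[OF this assms(1)] show ?thesis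
        by (simp add: exp_add[symmetric] mult_ac)
    qed
    then show "indicator ?E \<omega> \<le> exp (- (t * \<gamma> * real n)) * exp (t * ?Z \<omega>)"
      by (auto simp: indicator_def)
  qed
  also have "\<dots> = exp (- (t * \<gamma> * real n)) * expectation (\<lambda>\<omega>. exp (t * ?Z \<omega>) * 1)" using int by simp
  also have "expectation (\<lambda>\<omega>. exp (t * ?Z \<omega>) * 1) = (\<Sum>j\<in>UNIV. q $ j * ((transfer P t f ^^ n) (\<lambda>_. 1)) j)"
    by (rule expectation_exp_sum)
  finally show ?thesis .
qed

end

text \<open>
  Multiplication by \<open>sqrt s\<close> carries \<^const>\<open>transfer\<close> to \<open>twisted\<close>, and Cauchy-Schwarz
  separates the starting distribution from the iterates.
\<close>

lemma (in reversible_chain) transfer_le_norm_twisted: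
  "(\<Sum>j\<in>UNIV. q $ j * ((transfer P t f ^^ n) (\<lambda>_. 1)) j)
    \<le> weighted_norm q s * norm ((twisted t f ^^ n) sqrt_s)"
proof -
  have twist: "(twisted t f ^^ n) sqrt_s = (\<chi> j. sqrt (s $ j) * ((transfer P t f ^^ n) (\<lambda>_. 1)) j)"
  proof (induction n)
    case (Suc n)
    have "tilt t f (\<chi> j. sqrt (s $ j) * h j) = (\<chi> j. sqrt (s $ j) * (exp (t * f j) * h j))" for h
      by (simp add: tilt_def mult_ac)
    then show ?case
      unfolding funpow.simps o_apply Suc.IH by (simp add: twisted_def symm_transposed transfer_def)
  qed (simp add: sqrt_s_def)
  have nz: "sqrt (s $ j) \<noteq> 0" for j using s_pos[of j] by auto
  have "(\<Sum>j\<in>UNIV. q $ j * ((transfer P t f ^^ n) (\<lambda>_. 1)) j)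
      = (\<chi> j. q $ j / sqrt (s $ j)) \<bullet> (twisted t f ^^ n) sqrt_s"
    unfolding twist inner_vec_def using nz by simp
  also have "\<dots> \<le> weighted_norm q s * norm ((twisted t f ^^ n) sqrt_s)"
    unfolding weighted_norm_def by (rule norm_cauchy_schwarz)
  finally show ?thesis .
qed

section \<open>Tail bounds\<close>

theorem theorem1:
  fixes w :: "'v::finite \<Rightarrow> 'v \<Rightarrow> real"
    and P :: "real ^ 'v ^ 'v"
    and s q :: "real ^ 'v"
    and f :: "'v \<Rightarrow> real"
    and M :: "'a measure"
    and X :: "nat \<Rightarrow> 'a \<Rightarrow> 'v"
    and n :: nat
    and V \<gamma> :: real
  assumes "connected_weighted_graph w"
    and "P = transition_matrix w"
    and "stationary_distribution P s"
    and "Max (range (\<lambda>i. \<bar>f i\<bar>)) = 1"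
    and "(\<Sum>i\<in>UNIV. f i * s $ i) = 0"
    and "V = (\<Sum>i\<in>UNIV. (f i)\<^sup>2 * s $ i)"
    and "prob_vector q"
    and "random_walk M P q X"
    and "n \<ge> 1"
  shows "(\<exists>r0. is_arg_min (beta_bound (weighted_norm q s) V (spec_beta P) n \<gamma>)
                 (\<lambda>r. 0 \<le> r \<and> delta V ((spec_beta P)\<^sup>2) r \<le> 1) r0 \<and>
               ereal \<P>(\<omega> in M. 1 / real n * (\<Sum>i=1..n. f (X i \<omega>)) > \<gamma>)
                 \<le> beta_bound (weighted_norm q s) V (spec_beta P) n \<gamma> r0)
       \<and> (\<exists>r0. is_arg_min (alpha_bound (weighted_norm q s) V (spec_alpha P) n \<gamma>)
                 (\<lambda>r. 0 \<le> r \<and> delta V (spec_alpha P) r \<le> 1) r0 \<and>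
               ereal \<P>(\<omega> in M. 1 / real n * (\<Sum>i=1..n. f (X i \<omega>)) > \<gamma>)
                 \<le> alpha_bound (weighted_norm q s) V (spec_alpha P) n \<gamma> r0)"
proof -
  have f_le: "\<bar>f i\<bar> \<le> 1" for i unfolding assms(4)[symmetric] by (rule Max_ge) auto
  have "1 \<in> range (\<lambda>i. \<bar>f i\<bar>)" unfolding assms(4)[symmetric] by (rule Max_in) auto
  then obtain a where a: "\<bar>f a\<bar> = 1" by auto
  have s_sum: "(\<Sum>i\<in>UNIV. s $ i) = 1"
    using assms(3) by (simp add: stationary_distribution_def prob_vector_def)
  \<comment> \<open>A single vertex would force \<open>f = 0\<close>.\<close>
  have "\<exists>b. b \<noteq> a"
  proof (rule ccontr)
    assume "\<nexists>b. b \<noteq> a"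
    then have U: "UNIV = {a}" by auto
    have "f a * s $ a = 0" using assms(5) unfolding U by simp
    moreover have "s $ a = 1" using s_sum unfolding U by simp
    ultimately show False using a by simp
  qed
  then obtain b where "b \<noteq> a" by blast
  from assms(1-3) this interpret reversible_chain P s by (rule reversible_chain_of_graph)
  have V0: "0 < V"
    unfolding assms(6) using a s_pos[of a] s_pos
    by (intro sum_pos2[of _ a]) (auto simp: less_imp_le)
  \<comment> \<open>The centred function \<open>f\<close> itself provides a non-zero vector orthogonal to \<open>sqrt s\<close>.\<close>
  define z where "z = (\<chi> i. sqrt (s $ i) * f i)"
  have "z $ a \<noteq> 0" using a s_pos[of a] by (auto simp: z_def)
  then have "z \<noteq> 0" by auto
  moreover have "sqrt_s \<bullet> z = 0"
    using assms(5) s_pos by (simp add: z_def sqrt_s_def inner_vec_def less_imp_le mult_ac flip: mult.assoc)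
  ultimately have gap: "eigenvalues P - {1} \<noteq> {}" by (rule nontrivial_eigenvalues)
  define c where "c = weighted_norm q s"
  have c: "0 \<le> c" by (simp add: c_def weighted_norm_def)
  define p where "p = \<P>(\<omega> in M. 1 / real n * (\<Sum>i=1..n. f (X i \<omega>)) > \<gamma>)"
  have p_le: "p \<le> exp (- (t * \<gamma> * real n)) * (c * B)"
    if "0 \<le> t" "norm ((twisted t f ^^ n) sqrt_s) \<le> B" for t B
  proof -
    have "p \<le> exp (- (t * \<gamma> * real n)) * (\<Sum>j\<in>UNIV. q $ j * ((transfer P t f ^^ n) (\<lambda>_. 1)) j)"
      unfolding p_def using that(1) assms(9) by (intro chernoff_bound[OF assms(8)])
    also have "\<dots> \<le> exp (- (t * \<gamma> * real n)) * (c * norm ((twisted t f ^^ n) sqrt_s))"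
      unfolding c_def by (intro mult_left_mono transfer_le_norm_twisted) auto
    also have "\<dots> \<le> exp (- (t * \<gamma> * real n)) * (c * B)"
      using that(2) c by (intro mult_left_mono) auto
    finally show ?thesis .
  qed
  have "\<exists>r0. is_arg_min (beta_bound c V (spec_beta P) n \<gamma>)
      (\<lambda>r. 0 \<le> r \<and> delta V ((spec_beta P)\<^sup>2) r \<le> 1) r0 \<and> ereal p \<le> beta_bound c V (spec_beta P) n \<gamma> r0"
  proof (rule ex_arg_min_exp_bound[where m = "real n / 2" and b = 0 and \<gamma> = \<gamma> and c = c])
    show "0 < V" "0 \<le> c" "0 < real n / 2" "0 \<le> (spec_beta P)\<^sup>2" using V0 c assms(9) by auto
    show "(spec_beta P)\<^sup>2 \<le> 1" using spec_beta_bounds[OF gap] by (simp add: power_le_one)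
    show "beta_bound c V (spec_beta P) n \<gamma> r = (if delta V ((spec_beta P)\<^sup>2) r = 1 then \<infinity>
        else ereal (c * exp (exponent V ((spec_beta P)\<^sup>2) (real n / 2) 0 \<gamma> r)))" for r
      by (simp add: beta_bound_def exponent_def)
    fix r assume r: "0 \<le> r" "delta V ((spec_beta P)\<^sup>2) r < 1"
    from p_le[OF r(1) norm_twisted_le_beta[OF f_le assms(5,6) r]]
    show "p \<le> c * exp (exponent V ((spec_beta P)\<^sup>2) (real n / 2) 0 \<gamma> r)"
      by (simp add: exponent_def mult.left_commute[of _ c] exp_add[symmetric] algebra_simps)
  qed
  moreover have "\<exists>r0. is_arg_min (alpha_bound c V (spec_alpha P) n \<gamma>)
      (\<lambda>r. 0 \<le> r \<and> delta V (spec_alpha P) r \<le> 1) r0 \<and> ereal p \<le> alpha_bound c V (spec_alpha P) n \<gamma> r0"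
  proof (rule ex_arg_min_exp_bound[where m = "real n" and b = 2 and \<gamma> = \<gamma> and c = c])
    show "0 < V" "0 \<le> c" "0 < real n" using V0 c assms(9) by auto
    show "0 \<le> spec_alpha P" "spec_alpha P \<le> 1" using spec_alpha_bounds[OF gap] by auto
    show "alpha_bound c V (spec_alpha P) n \<gamma> r = (if delta V (spec_alpha P) r = 1 then \<infinity>
        else ereal (c * exp (exponent V (spec_alpha P) (real n) 2 \<gamma> r)))" for r
      by (simp add: alpha_bound_def exponent_def exp_add[symmetric] mult.assoc)
    fix r assume r: "0 \<le> r" "delta V (spec_alpha P) r < 1"
    have "0 \<le> 2 * r" using r(1) by simp
    from p_le[OF this norm_twisted_le_alpha[OF f_le assms(5,6) r]]
    show "p \<le> c * exp (exponent V (spec_alpha P) (real n) 2 \<gamma> r)"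
      by (simp add: exponent_def mult.left_commute[of _ c] exp_add[symmetric] algebra_simps)
  qed
  ultimately show ?thesis unfolding c_def p_def by blast
qed

end
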